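(* Let $n,r$ be positive integers and $S,T\subseteq[n]$. The statistics $\mathrm{cr}(\overline\Lambda)$ and $\mathrm{ne}(\overline\Lambda)$ have a symmetric joint distribution over all $r$-colored enhanced partitions $\overline\Lambda$ of $[n]$ with $\min(\overline\Lambda)\setminus\max(\overline\Lambda)=S$ and $\max(\overline\Lambda)\setminus\min(\overline\Lambda)=T$; that is, for all $a,b$ the number of such $\overline\Lambda$ with $(\mathrm{cr},\mathrm{ne})=(a,b)$ equals the number with $(\mathrm{cr},\mathrm{ne})=(b,a)$.
   Context: For a partition $P$ of $[n]=\{1,\dots,n\}$, $\mathrm{Arc}(P)$ is the set of pairs $(i,j)$ with $i,j$ in the same block and $j$ the least element of that block greater than $i$; $\min(P)$, $\max(P)$ are the sets of minimal and maximal elements of blocks. The enhanced arc set is $\overline{\mathrm{Arc}}(P)=\mathrm{Arc}(P)\cup\{(i,i):i\in\min(P)\cap\max(P)\}$. An $r$-colored enhanced partition is $\overline\Lambda=(P,\varphi)$ with $\varphi:\overline{\mathrm{Arc}}(P)\to[r]$, $\min(\overline\Lambda)=\min(P)$, $\max(\overline\Lambda)=\max(P)$; $\mathrm{cr}(\overline\Lambda)$ ($\mathrm{ne}(\overline\Lambda)$) is the largest $k$ such that there are $k$ enhanced arcs $(i_t,j_t)$ all of the same color with $i_1<\dots<i_k\le j_1<\dots<j_k$ (resp. $i_1<\dots<i_k\le j_k<\dots<j_1$). *)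

theory Defs
  imports Complex_Main "HOL-Library.Disjoint_Sets" "HOL-Library.FuncSet"
begin

definition Arc :: "nat set set \<Rightarrow> (nat \<times> nat) set" where
  "Arc P = {(i, j). \<exists>B\<in>P. i \<in> B \<and> j \<in> B \<and> i < j \<and> (\<forall>k\<in>B. i < k \<longrightarrow> j \<le> k)}"

definition min_set :: "nat set set \<Rightarrow> nat set" where
  "min_set P = Min ` P"

definition max_set :: "nat set set \<Rightarrow> nat set" where
  "max_set P = Max ` P"

definition enhanced_Arc :: "nat set set \<Rightarrow> (nat \<times> nat) set" where
  "enhanced_Arc P = Arc P \<union> {(i, i) | i. i \<in> min_set P \<inter> max_set P}"

type_synonym colored_partition = "nat set set \<times> (nat \<times> nat \<Rightarrow> nat)"

text \<open>The coloring is extensional (it takes the value \<open>undefined\<close> off the enhanced arc set),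
  so that two colorings agreeing on all enhanced arcs are the same object and are counted once.\<close>

definition colored_enhanced_partitions :: "nat \<Rightarrow> nat \<Rightarrow> colored_partition set" where
  "colored_enhanced_partitions n r =
     {(P, \<phi>). partition_on {1..n} P \<and> \<phi> \<in> enhanced_Arc P \<rightarrow>\<^sub>E {1..r}}"

definition mins :: "colored_partition \<Rightarrow> nat set" where
  "mins \<Lambda> = min_set (fst \<Lambda>)"

definition maxs :: "colored_partition \<Rightarrow> nat set" where
  "maxs \<Lambda> = max_set (fst \<Lambda>)"

definition monochromatic_arcs ::
  "colored_partition \<Rightarrow> nat \<Rightarrow> (nat \<Rightarrow> nat) \<Rightarrow> (nat \<Rightarrow> nat) \<Rightarrow> bool" where
  "monochromatic_arcs \<Lambda> k i j \<longleftrightarrow>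
     (\<exists>c. \<forall>t\<in>{1..k}. (i t, j t) \<in> enhanced_Arc (fst \<Lambda>) \<and> snd \<Lambda> (i t, j t) = c)"

definition has_crossing :: "colored_partition \<Rightarrow> nat \<Rightarrow> bool" where
  "has_crossing \<Lambda> k \<longleftrightarrow>
     (\<exists>i j. monochromatic_arcs \<Lambda> k i j \<and>
        (\<forall>s\<in>{1..k}. \<forall>t\<in>{1..k}. s < t \<longrightarrow> i s < i t \<and> j s < j t) \<and>
        (1 \<le> k \<longrightarrow> i k \<le> j 1))"

definition has_nesting :: "colored_partition \<Rightarrow> nat \<Rightarrow> bool" where
  "has_nesting \<Lambda> k \<longleftrightarrow>
     (\<exists>i j. monochromatic_arcs \<Lambda> k i j \<and>
        (\<forall>s\<in>{1..k}. \<forall>t\<in>{1..k}. s < t \<longrightarrow> i s < i t \<and> j t < j s) \<and>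
        (1 \<le> k \<longrightarrow> i k \<le> j k))"

definition cr :: "colored_partition \<Rightarrow> nat" where
  "cr \<Lambda> = Max {k. has_crossing \<Lambda> k}"

definition ne :: "colored_partition \<Rightarrow> nat" where
  "ne \<Lambda> = Max {k. has_nesting \<Lambda> k}"

text \<open>On the objects being counted, the maxima in \<open>cr\<close> and \<open>ne\<close> range over finite nonempty
  sets, and there are only finitely many such objects.\<close>

lemma partition_on_finite_block:
  assumes "partition_on {1..n::nat} P" "B \<in> P"
  shows "finite B" "B \<noteq> {}" "B \<subseteq> {1..n}"
proof -
  show *: "B \<subseteq> {1..n}" using assms by (auto simp: partition_on_def)
  show "finite B" using * by (rule finite_subset) simp
  show "B \<noteq> {}" using assms by (auto simp: partition_on_def)
qed

lemma enhanced_Arc_subset: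
  assumes "partition_on {1..n} P"
  shows "enhanced_Arc P \<subseteq> {1..n} \<times> {1..n}"
proof -
  have "Min B \<in> {1..n}" if "B \<in> P" for B
    using partition_on_finite_block[OF assms that] Min_in by blast
  then have "min_set P \<subseteq> {1..n}" by (auto simp: min_set_def)
  moreover have "Arc P \<subseteq> {1..n} \<times> {1..n}"
    using partition_on_finite_block(3)[OF assms] by (fastforce simp: Arc_def)
  ultimately show ?thesis by (auto simp: enhanced_Arc_def)
qed

lemma monochromatic_arcs_bound:
  assumes "\<Lambda> \<in> colored_enhanced_partitions n r" "monochromatic_arcs \<Lambda> k i j"
    and mono: "\<forall>s\<in>{1..k}. \<forall>t\<in>{1..k}. s < t \<longrightarrow> i s < i t"
  shows "k \<le> n"
proof -
  have "partition_on {1..n} (fst \<Lambda>)"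
    using assms(1) by (auto simp: colored_enhanced_partitions_def)
  then have "i ` {1..k} \<subseteq> {1..n}"
    using enhanced_Arc_subset assms(2) by (fastforce simp: monochromatic_arcs_def)
  moreover have "inj_on i {1..k}"
    by (rule linorder_inj_onI) (use mono in \<open>force+\<close>)
  ultimately have "card {1..k} \<le> card {1..n}"
    by (metis card_inj_on_le finite_atLeastAtMost)
  then show ?thesis by simp
qed

lemma cr_well_defined:
  assumes "\<Lambda> \<in> colored_enhanced_partitions n r"
  shows "finite {k. has_crossing \<Lambda> k}" "{k. has_crossing \<Lambda> k} \<noteq> {}"
proof -
  have "{k. has_crossing \<Lambda> k} \<subseteq> {..n}"
    using monochromatic_arcs_bound[OF assms] by (fastforce simp: has_crossing_def)
  then show "finite {k. has_crossing \<Lambda> k}" by (rule finite_subset) simp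
  have "has_crossing \<Lambda> 0" by (simp add: has_crossing_def monochromatic_arcs_def)
  then show "{k. has_crossing \<Lambda> k} \<noteq> {}" by blast
qed

lemma ne_well_defined:
  assumes "\<Lambda> \<in> colored_enhanced_partitions n r"
  shows "finite {k. has_nesting \<Lambda> k}" "{k. has_nesting \<Lambda> k} \<noteq> {}"
proof -
  have "{k. has_nesting \<Lambda> k} \<subseteq> {..n}"
    using monochromatic_arcs_bound[OF assms] by (fastforce simp: has_nesting_def)
  then show "finite {k. has_nesting \<Lambda> k}" by (rule finite_subset) simp
  have "has_nesting \<Lambda> 0" by (simp add: has_nesting_def monochromatic_arcs_def)
  then show "{k. has_nesting \<Lambda> k} \<noteq> {}" by blast
qed

lemma finite_colored_enhanced_partitions: "finite (colored_enhanced_partitions n r)"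
proof -
  have "colored_enhanced_partitions n r =
      (SIGMA P:{P. partition_on {1..n} P}. enhanced_Arc P \<rightarrow>\<^sub>E {1..r})"
    by (auto simp: colored_enhanced_partitions_def)
  moreover have "finite {P. partition_on {1..n} P}"
    by (rule finite_subset[of _ "Pow (Pow {1..n})"]) (auto simp: partition_on_def)
  moreover have "finite (enhanced_Arc P)" if "partition_on {1..n} P" for P
    using enhanced_Arc_subset[OF that] by (rule finite_subset) simp
  ultimately show ?thesis by (auto intro!: finite_SigmaI finite_PiE)
qed

end

theory Submission
  imports Defs "HOL-Library.Sublist"
begin

text \<open>
  The enhanced arcs of one colour form a matching of openers \<open>2 i\<close> to closers \<open>2 j + 1\<close>; an enhanced
  partition with prescribed \<open>min - max\<close> and \<open>max - min\<close> is the same as an arc set with prescribed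
  openers and closers, so it suffices to find, for every set of openers and closers, an injection
  on the matchings that exchanges crossings and nestings.

  Following Chen, Deng, Du, Stanley and Yan, read the positions of a matching from right to left:
  at a closer insert its opener into a tableau by row insertion, at an opener delete it (it is then
  the largest entry). The matching is determined by the resulting sequence of shapes, and every
  sequence of shapes with the right types of steps occurs. By Schensted's theorem the largest
  crossing is the maximal number of rows and the largest nesting the maximal number of columns of
  these shapes, so transposing all shapes is the required map.
\<close>

section \<open>Row insertion\<close>

text \<open>The colours can be treated one at a time because the exchange keeps the opener set and
  the closer set of each colour class. A point of [n] opens at most one arc and closes at most one,
  so arcs of different colours stay compatible and the new classes again form an enhanced arc set.
  The prescribed sets fit this: the points of min - max are exactly those that close no arc, the
  points of max - min exactly those that open none.

  All arcs of a crossing or nesting straddle a common position, so each of them is visible in the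
  word of a single position, and hence in a single shape. Gaining or losing a cell is a notion
  invariant under transposition, so the transposed sequence has the same types of steps. The
  obstacle is that no word is given for the transposed shapes: the new matching has to be rebuilt
  from left to right by reverse insertion, and it must then be shown that every opener is ejected
  exactly once.

  An injection gives one inequality between the two counts; interchanging a and b gives the
  other.\<close>

fun row_ins :: "nat \<Rightarrow> nat list \<Rightarrow> nat list \<times> nat option" where
  "row_ins x [] = ([x], None)"
| "row_ins x (y # ys) = (if x < y then (x # ys, Some y) else (case row_ins x ys of (r, b) \<Rightarrow> (y # r, b)))"

fun ins :: "nat \<Rightarrow> nat list list \<Rightarrow> nat list list" where
  "ins x [] = [[x]]"
| "ins x (r # T) = (case row_ins x r of (r', None) \<Rightarrow> r' # T | (r', Some y) \<Rightarrow> r' # ins y T)"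

fun column_dominates :: "nat list \<Rightarrow> nat list \<Rightarrow> bool" where
  "column_dominates r [] = True"
| "column_dominates [] (b # s) = False"
| "column_dominates (a # r) (b # s) = (a < b \<and> column_dominates r s)"

fun is_tableau :: "nat list list \<Rightarrow> bool" where
  "is_tableau [] = True"
| "is_tableau (r # T) = (r \<noteq> [] \<and> sorted_wrt (<) r \<and> (T \<noteq> [] \<longrightarrow> column_dominates r (hd T)) \<and> is_tableau T)"

abbreviation entries :: "nat list list \<Rightarrow> nat set" where
  "entries T \<equiv> set (concat T)"

lemma row_ins_None: "row_ins x r = (r', None) \<Longrightarrow> r' = r @ [x] \<and> (\<forall>y\<in>set r. y \<le> x)"
  by (induction r arbitrary: r') (auto split: if_splits prod.splits)

text \<open>The last equation carries \<open>insert\<close> on both sides because without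
  distinctness another copy of \<open>y\<close> may remain in \<open>r'\<close>.\<close>

lemma row_ins_Some:
  "row_ins x r = (r', Some y) \<Longrightarrow>
     length r' = length r \<and> x < y \<and> y \<in> set r \<and> x \<in> set r' \<and> insert y (set r') = insert x (set r)"
  by (induction r arbitrary: r') (fastforce split: if_splits prod.splits)+

lemma row_ins_Some_set:
  assumes "row_ins x r = (r', Some y)" "distinct r" "x \<notin> set r"
  shows "set r' = insert x (set r - {y})"
  using assms
proof (induction r arbitrary: r')
  case (Cons a r)
  show ?case
  proof (cases "x < a")
    case True with Cons.prems show ?thesis by auto
  next
    case False
    then obtain r1 where r1: "row_ins x r = (r1, Some y)" "r' = a # r1"
      using Cons.prems by (auto split: prod.splits)
    have "set r1 = insert x (set r - {y})" using Cons r1 by auto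
    moreover have "y \<noteq> a" using row_ins_Some[OF r1(1)] Cons.prems by auto
    ultimately show ?thesis using r1 Cons.prems by auto
  qed
qed auto

lemma row_ins_sorted:
  assumes "row_ins x r = (r', b)" "sorted_wrt (<) r" "x \<notin> set r"
  shows "sorted_wrt (<) r'"
  using assms
proof (induction r arbitrary: r')
  case (Cons a r)
  show ?case
  proof (cases "x < a")
    case True with Cons.prems show ?thesis by fastforce
  next
    case False
    then obtain r1 where r1: "row_ins x r = (r1, b)" "r' = a # r1"
      using Cons.prems by (auto split: prod.splits)
    have "set r1 \<subseteq> insert x (set r)"
      using row_ins_None[of x r r1] row_ins_Some[of x r r1] r1 by (cases b) auto
    with Cons r1 False show ?thesis by auto
  qed
qed auto

lemma ins_nonempty [simp]: "ins x T \<noteq> []"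
  by (cases T) (auto split: prod.splits option.splits)

lemma hd_ins: "T \<noteq> [] \<Longrightarrow> hd (ins x T) = fst (row_ins x (hd T))"
  by (cases T) (auto split: prod.splits option.splits)

lemma entries_ins:
  assumes "is_tableau T" "distinct (concat T)" "x \<notin> entries T"
  shows "entries (ins x T) = insert x (entries T) \<and> distinct (concat (ins x T))"
  using assms
proof (induction T arbitrary: x)
  case (Cons r T)
  have dr: "distinct r" and sr: "sorted_wrt (<) r" using Cons.prems by auto
  obtain r' b where rb: "row_ins x r = (r', b)" by fastforce
  show ?case
  proof (cases b)
    case None
    with rb row_ins_None[of x r r'] Cons.prems show ?thesis by auto
  next
    case (Some y)
    note R = row_ins_Some[of x r r' y] row_ins_Some_set[of x r r' y]
    have s: "set r' = insert x (set r - {y})" "y \<in> set r" using R rb Some dr Cons.prems by auto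
    have "y \<notin> entries T" using s Cons.prems by auto
    then have IH: "entries (ins y T) = insert y (entries T)" "distinct (concat (ins y T))"
      using Cons by auto
    have "distinct r'" using row_ins_sorted[OF rb sr] Cons.prems strict_sorted_iff by auto
    then show ?thesis using IH s rb Some Cons.prems by auto
  qed
qed auto

lemma column_dominates_length: "column_dominates r s \<Longrightarrow> length s \<le> length r"
  by (induction r s rule: column_dominates.induct) auto

lemma column_dominates_append: "column_dominates r s \<Longrightarrow> column_dominates (r @ t) s"
  by (induction r s rule: column_dominates.induct) auto

text \<open>Row insertion lowers one entry or appends one; neither harms a row that dominates from
  above.\<close>

lemma column_dominates_row_ins:
  "column_dominates r s \<Longrightarrow> column_dominates (fst (row_ins x r)) s"
  by (induction r s rule: column_dominates.induct) (auto split: prod.splits)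

text \<open>In the column from which \<open>y\<close> is bumped, an entry of \<open>s\<close>
  exceeds \<open>y\<close>. Hence \<open>y\<close> enters \<open>s\<close> in that column or further
  left, where all entries of \<open>r'\<close> are at most \<open>x\<close> and thus smaller than
  \<open>y\<close>.\<close>

lemma column_dominates_row_ins_row_ins:
  "column_dominates r s \<Longrightarrow> row_ins x r = (r', Some y) \<Longrightarrow> column_dominates r' (fst (row_ins y s))"
proof (induction r arbitrary: r' s)
  case (Cons a r)
  show ?case
  proof (cases "x < a")
    case True
    with Cons.prems show ?thesis by (cases s) auto
  next
    case False
    then obtain r1 where r1: "row_ins x r = (r1, Some y)" "r' = a # r1"
      using Cons.prems by (auto split: prod.splits)
    then have "a < y" using False row_ins_Some by fastforce
    moreover have "column_dominates r1 t" if "column_dominates r t" for t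
      using column_dominates_row_ins[OF that, of x] r1 by simp
    moreover have "column_dominates r1 (fst (row_ins y t))" if "column_dominates r t" for t
      using Cons.IH[OF that r1(1)] .
    ultimately show ?thesis using r1 Cons.prems(1) by (cases s) (force split: prod.splits)+
  qed
qed auto

lemma is_tableau_ins:
  assumes "is_tableau T" "distinct (concat T)" "x \<notin> entries T"
  shows "is_tableau (ins x T)"
  using assms
proof (induction T arbitrary: x)
  case (Cons r T)
  obtain r' b where rb: "row_ins x r = (r', b)" by fastforce
  have sr: "sorted_wrt (<) r'" using row_ins_sorted[OF rb] Cons.prems by auto
  show ?case
  proof (cases b)
    case None
    with rb row_ins_None[of x r r'] Cons.prems sr show ?thesis
      by (auto intro: column_dominates_append)
  next
    case (Some y)
    note R = row_ins_Some[of x r r' y]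
    have y: "y \<in> set r" "r' \<noteq> []" using R rb Some by auto
    then have "is_tableau (ins y T)" using Cons by auto
    moreover have "column_dominates r' (hd (ins y T))"
    proof (cases T)
      case Nil
      with R rb Some y Cons.prems column_dominates_row_ins_row_ins[of r "[]" x r' y] show ?thesis by auto
    next
      case (Cons s T')
      with R rb Some Cons.prems column_dominates_row_ins_row_ins[of r s x r' y] show ?thesis
        by (simp add: hd_ins del: ins.simps)
    qed
    ultimately show ?thesis using rb Some y sr by simp
  qed
qed auto

section \<open>Shapes as sets of cells, on which transposition is the coordinate swap\<close>

definition cells :: "nat list list \<Rightarrow> (nat \<times> nat) set" where
  "cells T = {(i, j). i < length T \<and> j < length (T ! i)}"

definition down_closed :: "(nat \<times> nat) set \<Rightarrow> bool" where
  "down_closed A \<longleftrightarrow> (\<forall>i j i' j'. (i, j) \<in> A \<longrightarrow> i' \<le> i \<longrightarrow> j' \<le> j \<longrightarrow> (i', j') \<in> A)"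

lemma cells_Nil [simp]: "cells [] = {}" by (simp add: cells_def)

lemma cells_Cons_0 [simp]: "(0, j) \<in> cells (r # T) \<longleftrightarrow> j < length r"
  by (simp add: cells_def)

lemma cells_Cons_Suc [simp]: "(Suc i, j) \<in> cells (r # T) \<longleftrightarrow> (i, j) \<in> cells T"
  by (simp add: cells_def)

lemma cells_eqI:
  assumes "\<And>j. (0, j) \<in> A \<longleftrightarrow> (0, j) \<in> B" "\<And>i j. (Suc i, j) \<in> A \<longleftrightarrow> (Suc i, j) \<in> B"
  shows "A = (B :: (nat \<times> nat) set)"
proof (rule set_eqI, clarify)
  fix i j show "(i, j) \<in> A \<longleftrightarrow> (i, j) \<in> B" using assms by (cases i) auto
qed

lemma down_closed_cells: "is_tableau T \<Longrightarrow> down_closed (cells T)"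
proof (induction T)
  case Nil then show ?case by (simp add: down_closed_def)
next
  case (Cons r T)
  have Y: "(i', j') \<in> cells T" if "(i, j) \<in> cells T" "i' \<le> i" "j' \<le> j" for i j i' j'
    using Cons that unfolding down_closed_def by auto
  have "(i', j') \<in> cells (r # T)" if a: "(i, j) \<in> cells (r # T)" "i' \<le> i" "j' \<le> j" for i j i' j'
  proof (cases i')
    case (Suc k)
    with a obtain l where "i = Suc l" by (cases i) auto
    with a Suc have "(l, j) \<in> cells T" "k \<le> l" by auto
    with a(3) have "(k, j') \<in> cells T" using Y by blast
    with Suc show ?thesis by simp
  next
    case 0
    show ?thesis
    proof (cases i)
      case 0 with a \<open>i' = 0\<close> show ?thesis by simp
    next
      case (Suc l)
      then have l: "(l, j) \<in> cells T" using a by simp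
      then obtain s T1 where T: "T = s # T1" by (cases T) auto
      have "(0, j) \<in> cells T" using Y[OF l] by blast
      then have "j < length s" using T by simp
      moreover have "length s \<le> length r" using Cons.prems T column_dominates_length by auto
      ultimately show ?thesis using a 0 by simp
    qed
  qed
  then show ?case unfolding down_closed_def by metis
qed

text \<open>Tableau rows are non-empty; a trailing empty row has no cells and would be invisible in
  the set.\<close>

lemma cells_eq_map_length:
  "is_tableau T \<Longrightarrow> is_tableau U \<Longrightarrow> cells T = cells U \<Longrightarrow> map length T = map length U"
proof (induction T arbitrary: U)
  case Nil
  show ?case
  proof (cases U)
    case (Cons s V)
    then have "(0, 0) \<in> cells U" using Nil(2) by simp
    then show ?thesis using Nil(3) by simp
  qed simp
next
  case (Cons r T)
  then obtain s V where U: "U = s # V" using cells_Cons_0[of 0 r T] by (cases U) auto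
  have "j < length r \<longleftrightarrow> j < length s" for j using Cons.prems(3) U cells_Cons_0 by blast
  then have "length r = length s" by (metis linorder_neqE_nat less_irrefl)
  moreover have "cells T = cells V"
  proof (rule set_eqI, clarify)
    fix i j show "(i, j) \<in> cells T \<longleftrightarrow> (i, j) \<in> cells V"
      using Cons.prems(3) U cells_Cons_Suc by blast
  qed
  ultimately show ?case using Cons U by auto
qed

lemma cells_ins:
  "\<exists>c. c \<notin> cells T \<and> cells (ins x T) = insert c (cells T)"
proof (induction T arbitrary: x)
  case Nil
  have "cells (ins x []) = {(0, 0)}" by (auto simp: cells_def)
  then show ?case by auto
next
  case (Cons r T)
  obtain r' b where rb: "row_ins x r = (r', b)" by fastforce
  show ?case
  proof (cases b)
    case None
    have "cells (ins x (r # T)) = insert (0, length r) (cells (r # T))"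
      using row_ins_None[of x r r'] rb None by (intro cells_eqI) auto
    then show ?thesis by (metis cells_Cons_0 less_irrefl)
  next
    case (Some y)
    obtain i j where c: "(i, j) \<notin> cells T" "cells (ins y T) = insert (i, j) (cells T)"
      using Cons[of y] by auto
    have "cells (ins x (r # T)) = insert (Suc i, j) (cells (r # T))"
      using row_ins_Some[of x r r'] rb Some c by (intro cells_eqI) auto
    then show ?thesis using c by (metis cells_Cons_Suc)
  qed
qed

section \<open>Reversing row insertion\<close>

lemma row_ins_inj:
  "row_ins x r = (q, Some y) \<Longrightarrow> row_ins x' r' = (q, Some y) \<Longrightarrow>
   sorted_wrt (<) r \<Longrightarrow> sorted_wrt (<) r' \<Longrightarrow> x = x' \<and> r = r'"
proof (induction r arbitrary: r' q)
  case (Cons a r)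
  from Cons.prems obtain a' s where r': "r' = a' # s" by (cases r') auto
  show ?case
  proof (cases "x < a"; cases "x' < a'")
    \<comment> \<open>The inserted entry is the largest entry of \<open>q\<close> below
      \<open>y\<close>, so the result reveals it. The two mixed cases are impossible: the entry
      inserted further right would lie in the tail of the other sorted row and yet be smaller than
      its head \<open>y\<close>.\<close>
    assume A: "x < a" "\<not> x' < a'"
    then obtain r1 where r1: "row_ins x' s = (r1, Some y)" "q = a' # r1"
      using Cons.prems r' by (auto split: prod.splits)
    have "q = x # r" "y = a" using A Cons.prems by auto
    moreover have "x' < a" "x' \<in> set r"
      using row_ins_Some[OF r1(1)] r1 calculation by auto
    ultimately show ?thesis using Cons.prems(3) by auto
  next
    assume A: "\<not> x < a" "x' < a'"
    then obtain r1 where r1: "row_ins x r = (r1, Some y)" "q = a # r1"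
      using Cons.prems r' by (auto split: prod.splits)
    have "q = x' # s" "y = a'" using A Cons.prems r' by auto
    moreover have "x < a'" "x \<in> set s"
      using row_ins_Some[OF r1(1)] r1 calculation by auto
    ultimately show ?thesis using Cons.prems(4) r' by auto
  next
    assume A: "\<not> x < a" "\<not> x' < a'"
    then obtain r1 where r1: "row_ins x r = (r1, Some y)" "q = a # r1"
      using Cons.prems r' by (auto split: prod.splits)
    moreover obtain r2 where r2: "row_ins x' s = (r2, Some y)" "q = a' # r2"
      using A Cons.prems r' by (auto split: prod.splits)
    ultimately have "x = x' \<and> r = s" using Cons.IH[of r1 s] Cons.prems(3,4) r' by simp
    then show ?thesis using r1 r2 r' by simp
  qed (use Cons.prems r' in auto)
qed auto

text \<open>The old row lengths tell in which row the new cell was created. Reverse bumping starts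
  there and is deterministic.\<close>

lemma ins_inj:
  "ins x T = ins x' T' \<Longrightarrow> map length T = map length T' \<Longrightarrow> is_tableau T \<Longrightarrow> is_tableau T' \<Longrightarrow> x = x' \<and> T = T'"
proof (induction T arbitrary: x x' T')
  case (Cons r T)
  then obtain r' S where T': "T' = r' # S" by auto
  obtain q b where q: "row_ins x r = (q, b)" by fastforce
  obtain q' b' where q': "row_ins x' r' = (q', b')" by fastforce
  have e: "q = q'" using Cons.prems T' q q' by (auto split: option.splits)
  have l: "length r = length r'" using Cons.prems T' by auto
  note R = row_ins_None[of x r q] row_ins_None[of x' r' q'] row_ins_Some[of x r q] row_ins_Some[of x' r' q']
  show ?case
  proof (cases b; cases b')
    fix y y' assume b: "b = Some y" "b' = Some y'"
    have "y = y' \<and> T = S" using Cons b q q' T' by auto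
    with row_ins_inj[of x r q y x' r'] show ?thesis using b q q' T' Cons.prems e by auto
  qed (use Cons.prems T' q q' e l R in auto)
qed auto

lemma row_ins_max: "\<forall>y\<in>set r. y < m \<Longrightarrow> row_ins m r = (r @ [m], None)"
  by (induction r) auto

text \<open>\<open>x\<close> is the largest entry of \<open>r\<close> below \<open>y\<close>, and
  \<open>y\<close> takes its place in \<open>r'\<close>; the condition on \<open>hd r\<close> makes
  such an entry exist.\<close>

lemma row_ins_exists:
  "sorted_wrt (<) r \<Longrightarrow> r \<noteq> [] \<Longrightarrow> hd r < y \<Longrightarrow> y \<notin> set r \<Longrightarrow>
   \<exists>x r'. row_ins x r' = (r, Some y) \<and> sorted_wrt (<) r' \<and> length r' = length r \<and>
     x \<in> set r \<and> set r' = insert y (set r - {x})"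
proof (induction r)
  case (Cons a r)
  show ?case
  proof (cases "r \<noteq> [] \<and> hd r < y")
    case True
    then obtain x r' where I: "row_ins x r' = (r, Some y)" "sorted_wrt (<) r'" "length r' = length r"
     "x \<in> set r" "set r' = insert y (set r - {x})" using Cons by auto
    have "a < x" using I Cons.prems by auto
    moreover have "sorted_wrt (<) (a # r')" using I Cons.prems by auto
    ultimately show ?thesis using I Cons.prems by (intro exI[of _ x] exI[of _ "a # r'"]) auto
  next
    case False
    have "sorted_wrt (<) (y # r)"
    proof (cases r)
      case (Cons b s)
      with False have "y < b" using Cons.prems by auto
      with Cons Cons.prems show ?thesis by (auto) 
    qed simp
    then show ?thesis using False Cons.prems by (intro exI[of _ a] exI[of _ "y # r"]) auto
  qed
qed auto

text \<open>Undoing the bump raises a single entry of the upper row, from \<open>x\<close> to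
  \<open>y\<close>, and everything below exceeds \<open>y\<close>.\<close>

lemma column_dominates_unbump_row:
  "row_ins x r = (r', Some y) \<Longrightarrow> column_dominates r' s \<Longrightarrow> \<forall>z\<in>set s. y < z \<Longrightarrow> column_dominates r s"
proof (induction r arbitrary: r' s)
  case (Cons a r)
  show ?case
  proof (cases "x < a")
    case True with Cons.prems show ?thesis by (cases s) auto
  next
    case False
    then obtain r1 where r1: "row_ins x r = (r1, Some y)" "r' = a # r1"
      using Cons.prems by (auto split: prod.splits)
    with Cons show ?thesis by (cases s) auto
  qed
qed auto

text \<open>Converse of \<open>column_dominates_row_ins_row_ins\<close>, for reverse insertion. In
  \<open>s'\<close> the entry \<open>y\<close> stands below an entry smaller than \<open>y\<close>,
  and \<open>x\<close> is the largest such entry of \<open>r'\<close>. Hence \<open>y\<close>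
  returns to the upper row in the column it leaves or further right, where every entry of
  \<open>s\<close> exceeds \<open>y\<close>.\<close>

lemma column_dominates_unbump:
  "row_ins x r = (r', Some y) \<Longrightarrow> row_ins y s = (s', b) \<Longrightarrow> column_dominates r' s' \<Longrightarrow>
   sorted_wrt (<) r \<Longrightarrow> sorted_wrt (<) s \<Longrightarrow> column_dominates r s"
proof (induction r arbitrary: r' s s')
  case (Cons a r)
  show ?case
  proof (cases s)
    case s: (Cons c t)
    show ?thesis
    proof (cases "x < a")
      case True
      then have r': "r' = x # r" "y = a" using Cons.prems by auto
      show ?thesis
      proof (cases "a < c")
        case True
        with Cons.prems s r' show ?thesis by auto
      next
        case False
        then obtain t1 where t1: "row_ins a t = (t1, b)" "s' = c # t1"
          using Cons.prems s r' by (auto split: prod.splits)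
        \<comment> \<open>This case is impossible: domination would put the head of \<open>r\<close>
          below \<open>hd t1\<close>, hence below \<open>a\<close>, while all of \<open>r\<close>
          exceeds \<open>a\<close>.\<close>
        then have "t1 \<noteq> []" "hd t1 \<le> a"
          by (cases t; auto split: if_splits prod.splits)+
        moreover have "column_dominates r t1" using Cons.prems r' t1 by auto
        ultimately show ?thesis using Cons.prems(4) by (cases r; cases t1) auto
      qed
    next
      case False
      then obtain r1 where r1: "row_ins x r = (r1, Some y)" "r' = a # r1"
        using Cons.prems by (auto split: prod.splits)
      have "a < y" using False row_ins_Some[OF r1(1)] by auto
      show ?thesis
      proof (cases "y < c")
        case True
        then have "s' = y # t" using Cons.prems s by auto
        then have "column_dominates r1 t" using Cons.prems r1 by auto
        then have "column_dominates r t"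
          using True Cons.prems(5) s by (intro column_dominates_unbump_row[OF r1(1)]) auto
        with True \<open>a < y\<close> s show ?thesis by auto
      next
        case False
        then obtain t1 where t1: "row_ins y t = (t1, b)" "s' = c # t1"
          using Cons.prems s by (auto split: prod.splits)
        with Cons r1 s show ?thesis by auto
      qed
    qed
  qed simp
qed auto

lemma column_dominates_below: "column_dominates r s \<Longrightarrow> v \<in> set s \<Longrightarrow> \<exists>u\<in>set r. u < v"
  by (induction r s rule: column_dominates.induct) auto

lemma ins_row_member: "x \<in> set (hd (ins x T))"
proof (cases T)
  case (Cons r T1)
  obtain r' b where rb: "row_ins x r = (r', b)" by fastforce
  with row_ins_None[of x r r'] row_ins_Some[of x r r'] Cons show ?thesis by (cases b) auto
qed auto

text \<open>Reverse insertion starting at the corner \<open>c\<close>: the entry there leaves its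
  row, and in every row above the ejected entry replaces the largest smaller one. What finally
  leaves the first row is \<open>x\<close>.\<close>

lemma ins_exists:
  "is_tableau T \<Longrightarrow> distinct (concat T) \<Longrightarrow> c \<in> cells T \<Longrightarrow> down_closed (cells T - {c}) \<Longrightarrow>
   \<exists>x T'. is_tableau T' \<and> ins x T' = T \<and> cells T' = cells T - {c} \<and> distinct (concat T') \<and>
     x \<notin> entries T' \<and> entries T = insert x (entries T')"
proof (induction T arbitrary: c)
  case (Cons q T)
  obtain i j where c: "c = (i, j)" by (cases c)
  show ?case
  proof (cases i)
    case 0
    have Y: "(i', j') \<in> cells (q # T)" "(i', j') \<noteq> c"
      if "(k, l) \<in> cells (q # T)" "(k, l) \<noteq> c" "i' \<le> k" "j' \<le> l" for k l i' j'
      using Cons.prems(4) that unfolding down_closed_def by blast+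
    have j: "j < length q" using Cons.prems(3) c 0 by simp
    have "\<not> Suc j < length q" using Y(2)[of 0 "Suc j" 0 j] c 0 by auto
    then have lq: "length q = Suc j" using j by simp
    have qe: "butlast q @ [last q] = q" using Cons.prems by auto
    have nT: "length (hd T) \<le> j" if "T \<noteq> []"
    proof (rule ccontr)
      assume "\<not> length (hd T) \<le> j"
      then have "(Suc 0, j) \<in> cells (q # T)" using that by (cases T) auto
      then show False using Y(2)[of "Suc 0" j 0 j] c 0 by auto
    qed
    have sm: "\<forall>u\<in>set (butlast q). u < last q"
      using Cons.prems(1) qe by (metis sorted_wrt_append is_tableau.simps(2) list.set_intros(1))
    have rq: "row_ins (last q) (butlast q) = (q, None)" using row_ins_max[OF sm] qe by simp
    show ?thesis
    \<comment> \<open>Removing the only entry of the first row would leave an empty row; in this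
      case the whole tableau is one cell and \<open>T'\<close> has to be empty.\<close>
    proof (cases "j = 0")
      case True
      then have "T = []" using nT Cons.prems(1) by (cases T) auto
      moreover obtain z where "q = [z]" using True lq by (cases q) auto
      moreover have "cells [q] - {c} = {}" using True lq c 0 by (auto simp: cells_def)
      ultimately show ?thesis by (intro exI[of _ z] exI[of _ "[]"]) auto
    next
      case False
      have dom: "column_dominates (butlast q) s" if "column_dominates q s" "length s \<le> length (butlast q)" for s
      proof -
        have "column_dominates (u @ [z]) s \<Longrightarrow> length s \<le> length u \<Longrightarrow> column_dominates u s" for u z
          by (induction u s rule: column_dominates.induct) auto
        from this[of "butlast q" "last q"] that qe show ?thesis by simp
      qed
      have sb: "sorted_wrt (<) (butlast q)"
        using Cons.prems(1) qe by (metis sorted_wrt_append is_tableau.simps(2))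
      have "butlast q \<noteq> []" using False lq by (metis length_butlast diff_Suc_1 list.size(3))
      then have t: "is_tableau (butlast q # T)" using Cons.prems(1) dom nT lq sb by auto
      have cc: "cells (butlast q # T) = cells (q # T) - {c}"
        using lq c 0 by (intro cells_eqI) auto
      have "distinct (concat (butlast q # T)) \<and> last q \<notin> entries (butlast q # T) \<and>
          entries (q # T) = insert (last q) (entries (butlast q # T))"
      proof -
        have "distinct (concat ((butlast q @ [last q]) # T))" "entries (q # T) = entries ((butlast q @ [last q]) # T)"
          using Cons.prems(2) qe by simp_all
        then show ?thesis by auto
      qed
      then show ?thesis using t cc rq
        by (intro exI[of _ "last q"] exI[of _ "butlast q # T"]) auto
    qed
  next
    case (Suc k)
    have yk: "down_closed (cells T - {(k, j)})"
      unfolding down_closed_def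
    proof (intro allI impI)
      fix a b a' b' assume A: "(a, b) \<in> cells T - {(k, j)}" "a' \<le> a" "b' \<le> b"
      then have "(Suc a, b) \<in> cells (q # T) - {c}" using c Suc by auto
      then have "(Suc a', b') \<in> cells (q # T) - {c}"
        using Cons.prems(4) A unfolding down_closed_def by (meson Suc_le_mono)
      then show "(a', b') \<in> cells T - {(k, j)}" using c Suc by auto
    qed
    have "(k, j) \<in> cells T" using Cons.prems c Suc by simp
    then obtain y T' where I: "is_tableau T'" "ins y T' = T" "cells T' = cells T - {(k, j)}"
       "distinct (concat T')" "y \<notin> entries T'" "entries T = insert y (entries T')"
      using Cons.IH[of "(k, j)"] yk Cons.prems by auto
    have T: "T \<noteq> []" using \<open>(k, j) \<in> cells T\<close> by auto
    have d: "column_dominates q (hd T)" using Cons.prems T by auto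
    \<comment> \<open>Since \<open>y\<close> lies in the row directly below \<open>q\<close>, some
      entry of \<open>q\<close> is smaller than \<open>y\<close>, which makes the reverse bump out
      of \<open>q\<close> possible.\<close>
    have "y \<in> set (hd T)" using ins_row_member I by metis
    then obtain u where "u \<in> set q" "u < y" using column_dominates_below d by blast
    moreover have "hd q \<le> u" using Cons.prems(1) \<open>u \<in> set q\<close> by (cases q) auto
    ultimately have "hd q < y" by simp
    moreover have yq: "y \<notin> set q" using Cons.prems(2) I by auto
    ultimately obtain x r where r: "row_ins x r = (q, Some y)" "sorted_wrt (<) r" "length r = length q"
       "x \<in> set q" "set r = insert y (set q - {x})"
      using row_ins_exists[of q y] Cons.prems by auto
    have "column_dominates r (hd T')" if T': "T' \<noteq> []"
    proof -
      obtain s' b where s': "row_ins y (hd T') = (s', b)" by fastforce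
      then have "s' = hd T" using hd_ins[OF T', of y] I by simp
      then show ?thesis using column_dominates_unbump[OF r(1) s'] d r I T' by (cases T') auto
    qed
    then have t: "is_tableau (r # T')" using r I Cons.prems by auto
    have cc: "cells (r # T') = cells (q # T) - {c}"
      using r I c Suc by (intro cells_eqI) auto
    have dr: "distinct r" using r strict_sorted_iff by blast
    have "ins x (r # T') = q # T" using r I by simp
    moreover have "set r \<inter> entries T' = {}" "x \<notin> set r" "x \<notin> entries T'"
      using r I yq Cons.prems(2) by auto
    moreover have "entries (q # T) = insert x (entries (r # T'))" using r I by auto
    ultimately show ?thesis using t cc dr I(4)
      by (intro exI[of _ x] exI[of _ "r # T'"]) (simp del: ins.simps)
  qed
qed auto

text \<open>A row index beyond the end of the tableau is harmless: the entry then starts a new row.\<close>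

fun add_cell :: "nat \<Rightarrow> nat \<Rightarrow> nat list list \<Rightarrow> nat list list" where
  "add_cell m i [] = [[m]]"
| "add_cell m 0 (r # T) = (r @ [m]) # T"
| "add_cell m (Suc i) (r # T) = r # add_cell m i T"

section \<open>Adjoining the largest entry\<close>

lemma row_ins_append_max:
  "row_ins x r = (r', Some y) \<Longrightarrow> row_ins x (r @ [m]) = (r' @ [m], Some y)"
proof (induction r arbitrary: r')
  case (Cons a r)
  then show ?case by (cases "row_ins x r"; cases "x < a") auto
qed simp

lemma row_ins_append_max_None:
  "row_ins x r = (r', None) \<Longrightarrow> x < m \<Longrightarrow> row_ins x (r @ [m]) = (r @ [x], Some m)"
proof (induction r arbitrary: r')
  case (Cons a r)
  then show ?case by (cases "row_ins x r"; cases "x < a") auto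
qed simp

lemma ins_max: "\<forall>y\<in>entries T. y < m \<Longrightarrow> ins m T = add_cell m 0 T"
  by (cases T) (auto simp: row_ins_max)

text \<open>The largest entry never influences where another entry goes. It can only be displaced
  from the end of a row, and then it goes to the end of the next one; so only its row index
  changes.\<close>

lemma ins_add_cell:
  "\<forall>y\<in>entries T. y < m \<Longrightarrow> x < m \<Longrightarrow> \<exists>i'. ins x (add_cell m i T) = add_cell m i' (ins x T)"
proof (induction T arbitrary: x i)
  case Nil
  have "ins x (add_cell m i []) = add_cell m 1 (ins x [])" if "x < m" using that by simp
  with Nil show ?case by blast
next
  case (Cons r T)
  obtain r' b where rb: "row_ins x r = (r', b)" by fastforce
  have m: "\<forall>y\<in>entries T. y < m" using Cons.prems by auto
  show ?case
  proof (cases i)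
    case 0
    show ?thesis
    proof (cases b)
      case None
      then have "r' = r @ [x]" using row_ins_None rb by blast
      \<comment> \<open>Without \<open>m\<close> the entry \<open>x\<close> would be appended; now
        it takes the place of \<open>m\<close>, which moves to the second row.\<close>
      then have "ins x (add_cell m i (r # T)) = add_cell m 1 (ins x (r # T))"
        using row_ins_append_max_None[of x r r' m] rb 0 None Cons.prems ins_max[OF m] by simp
      then show ?thesis by blast
    next
      case (Some y)
      have "ins x (add_cell m i (r # T)) = add_cell m 0 (ins x (r # T))"
        using row_ins_append_max[of x r r' y m] rb 0 Some Cons.prems by simp
      then show ?thesis by blast
    qed
  next
    case (Suc k)
    show ?thesis
    proof (cases b)
      case None
      then have "ins x (add_cell m i (r # T)) = add_cell m i (ins x (r # T))"
        using rb Suc by simp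
      then show ?thesis by blast
    next
      case (Some y)
      have "y < m" using row_ins_Some[of x r r' y] rb Some Cons.prems by auto
      then obtain i' where "ins y (add_cell m k T) = add_cell m i' (ins y T)" using Cons m by blast
      then have "ins x (add_cell m i (r # T)) = add_cell m (Suc i') (ins x (r # T))"
        using rb Suc Some by simp
      then show ?thesis by blast
    qed
  qed
qed

text \<open>Only the tableaux are equated, since different indices beyond the last row give the same
  tableau.\<close>

lemma add_cell_inj:
  "map length (add_cell m i T) = map length (add_cell m j T) \<Longrightarrow> add_cell m i T = add_cell m j T"
proof (induction T arbitrary: i j)
  case (Cons r T)
  then show ?case by (cases i; cases j) auto
qed simp

lemma cells_add_cell:
  "\<exists>c. c \<notin> cells T \<and> cells (add_cell m i T) = insert c (cells T)"
proof (induction T arbitrary: i)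
  case Nil
  have "cells (add_cell m i []) = {(0, 0)}" by (auto simp: cells_def)
  then show ?case by auto
next
  case (Cons r T)
  show ?case
  proof (cases i)
    case 0
    have "cells (add_cell m i (r # T)) = insert (0, length r) (cells (r # T))"
      using 0 by (intro cells_eqI) auto
    then show ?thesis by (metis cells_Cons_0 less_irrefl)
  next
    case (Suc k)
    obtain a b where c: "(a, b) \<notin> cells T" "cells (add_cell m k T) = insert (a, b) (cells T)"
      using Cons[of k] by auto
    have "cells (add_cell m i (r # T)) = insert (Suc a, b) (cells (r # T))"
      using Suc c by (intro cells_eqI) auto
    then show ?thesis using c by (metis cells_Cons_Suc)
  qed
qed

lemma entries_add_cell:
  "entries (add_cell m i T) = insert m (entries T)"
  "m \<notin> entries T \<Longrightarrow> distinct (concat T) \<Longrightarrow> distinct (concat (add_cell m i T))"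
proof -
  show *: "entries (add_cell m i T) = insert m (entries T)" for i
    by (induction m i T rule: add_cell.induct) auto
  show "m \<notin> entries T \<Longrightarrow> distinct (concat T) \<Longrightarrow> distinct (concat (add_cell m i T))"
  proof (induction T arbitrary: i)
    case (Cons r T)
    have "entries (add_cell m k T) = insert m (entries T)" for k
      by (induction m k T rule: add_cell.induct) auto
    then show ?case using Cons by (cases i) auto
  qed simp
qed

lemma column_dominates_snoc:
  "column_dominates r s \<Longrightarrow> length s < length r \<Longrightarrow> \<forall>u\<in>set r. u < m \<Longrightarrow> column_dominates r (s @ [m])"
proof (induction r s rule: column_dominates.induct)
  case (1 r)
  then show ?case by (cases r) auto
qed auto

text \<open>The index is the row of \<open>c\<close>. A cell whose addition keeps the diagram closed
  ends its row and lies below filled cells, so the largest entry may stand there.\<close>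

lemma add_cell_exists:
  "is_tableau T \<Longrightarrow> c \<notin> cells T \<Longrightarrow> down_closed (insert c (cells T)) \<Longrightarrow> \<forall>y\<in>entries T. y < m \<Longrightarrow>
   \<exists>i. is_tableau (add_cell m i T) \<and> cells (add_cell m i T) = insert c (cells T)"
proof (induction T arbitrary: c)
  case Nil
  obtain a b where c: "c = (a, b)" by (cases c)
  have "(0, 0) \<in> {c}" using Nil(3) unfolding down_closed_def c by (metis cells_Nil insertI1 le0)
  then have "cells (add_cell m 0 []) = insert c (cells [])" by (auto simp: cells_def)
  then show ?case by (intro exI[of _ 0]) simp
next
  case (Cons r T)
  obtain a b where c: "c = (a, b)" by (cases c)
  have Y: "(i', j') \<in> cells (r # T) \<or> (i', j') = c"
    if "(k, l) \<in> cells (r # T) \<or> (k, l) = c" "i' \<le> k" "j' \<le> l" for k l i' j'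
    using Cons.prems(3) that unfolding down_closed_def by blast
  show ?case
  proof (cases a)
    case 0
    have "\<not> b < length r" using Cons.prems(2) c 0 by simp
    moreover have "\<not> length r < b" using Y[of a b 0 "length r"] c 0 by auto
    ultimately have b: "b = length r" by simp
    have "cells (add_cell m 0 (r # T)) = insert c (cells (r # T))"
      using c b 0 by (intro cells_eqI) auto
    moreover have "is_tableau (add_cell m 0 (r # T))"
      using Cons.prems by (auto simp: sorted_wrt_append column_dominates_append)
    ultimately show ?thesis by blast
  next
    case (Suc k)
    have n: "(k, b) \<notin> cells T" using Cons.prems(2) c Suc by simp
    have yk: "down_closed (insert (k, b) (cells T))"
      unfolding down_closed_def
    proof (intro allI impI)
      fix p q p' q' assume A: "(p, q) \<in> insert (k, b) (cells T)" "p' \<le> p" "q' \<le> q"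
      then have "(Suc p, q) \<in> cells (r # T) \<or> (Suc p, q) = c" using c Suc by auto
      then have "(Suc p', q') \<in> cells (r # T) \<or> (Suc p', q') = c" by (rule Y) (use A in auto)
      then show "(p', q') \<in> insert (k, b) (cells T)" using c Suc by auto
    qed
    obtain i where i: "is_tableau (add_cell m i T)" "cells (add_cell m i T) = insert (k, b) (cells T)"
      using Cons.IH[OF _ n yk] Cons.prems by auto
    have cc: "cells (add_cell m (Suc i) (r # T)) = insert c (cells (r # T))"
      using c Suc i by (intro cells_eqI) auto
    \<comment> \<open>The cell of the first row in the column of \<open>c\<close> is filled; this is
      the strict length condition of \<open>column_dominates_snoc\<close> when \<open>c\<close> lies
      in the second row.\<close>
    have br: "b < length r" using Y[of a b 0 b] c Suc by auto
    have "column_dominates r (hd (add_cell m i T))"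
    proof (cases T)
      case Nil
      then show ?thesis using Cons.prems by (cases r) auto
    next
      case T: (Cons s T')
      show ?thesis
      proof (cases i)
        case 0
        have "(0, length s) \<in> cells (add_cell m i T)" using T 0 by simp
        then have "(0, length s) = (k, b)" using i(2) T by simp
        then have "length s < length r" using br by simp
        then show ?thesis using T 0 Cons.prems by (auto intro!: column_dominates_snoc)
      qed (use T Cons.prems in auto)
    qed
    then have "is_tableau (add_cell m (Suc i) (r # T))" using i Cons.prems by auto
    then show ?thesis using cc by blast
  qed
qed

section \<open>Knuth equivalence and Schensted's theorem\<close>

definition has_chain :: "(nat \<Rightarrow> nat \<Rightarrow> bool) \<Rightarrow> nat \<Rightarrow> nat list \<Rightarrow> bool" where
  "has_chain R k w \<longleftrightarrow> (\<exists>s. subseq s w \<and> sorted_wrt R s \<and> length s = k)"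

text \<open>Swapping the neighbours \<open>a\<close> and \<open>b\<close> destroys only chains that
  use both. Such a chain does not use \<open>y\<close>, because \<open>y\<close> lies between
  \<open>a\<close> and \<open>b\<close> in the order but not in the word. So \<open>y\<close> can
  replace \<open>a\<close> in the first case and \<open>b\<close> in the second without changing the
  length.\<close>

lemma has_chain_swap:
  assumes R: "transp R" "irreflp R" and ab: "R a b \<Longrightarrow> R a y \<and> R y b"
  shows "has_chain R k (u @ [y, a, b] @ v) \<Longrightarrow> has_chain R k (u @ [y, b, a] @ v)"
    and "has_chain R k (u @ [a, b, y] @ v) \<Longrightarrow> has_chain R k (u @ [b, a, y] @ v)"
proof -
  have key: "has_chain R k (u @ q @ v)"
    if hc: "has_chain R k (u @ p @ v)"
      and pq: "\<And>m. subseq m p \<Longrightarrow> sorted_wrt R m \<Longrightarrow> subseq m q \<or> (m = [a, b] \<and> (subseq [y, b] q \<or> subseq [a, y] q))"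
    for p q
  proof -
    from hc obtain s where s: "subseq s (u @ p @ v)" "sorted_wrt R s" "length s = k"
      by (auto simp: has_chain_def)
    then obtain s1 m s2 where d: "s = s1 @ m @ s2" "subseq s1 u" "subseq m p" "subseq s2 v"
      by (auto simp: subseq_append_iff elim!: subseq_appendE)
    have sm: "sorted_wrt R m" using s d by (simp add: sorted_wrt_append)
    have R1: "subseq (s1 @ m' @ s2) (u @ q @ v)" if "subseq m' q" for m'
      using d that by (intro list_emb_append_mono)
    consider "subseq m q" | "m = [a, b]" "subseq [y, b] q" | "m = [a, b]" "subseq [a, y] q"
      using pq[OF d(3) sm] by auto
    then show ?thesis
    proof cases
      case 1
      then show ?thesis using R1 d s unfolding has_chain_def by blast
    next
      case 2
      then have "R a b" using sm by simp
      then have "sorted_wrt R (s1 @ [y, b] @ s2)"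
        using s d 2 ab R(1) by (auto simp: sorted_wrt_append dest: transpD)
      then show ?thesis using R1[OF 2(2)] d s 2 unfolding has_chain_def
        by (intro exI[of _ "s1 @ [y, b] @ s2"]) auto
    next
      case 3
      then have "R a b" using sm by simp
      then have "sorted_wrt R (s1 @ [a, y] @ s2)"
        using s d 3 ab R(1) by (auto simp: sorted_wrt_append dest: transpD)
      then show ?thesis using R1[OF 3(2)] d s 3 unfolding has_chain_def
        by (intro exI[of _ "s1 @ [a, y] @ s2"]) auto
    qed
  qed
  have no: "\<not> (R y a \<and> R a b)" "\<not> (R a b \<and> R b y)"
    using ab R by (metis irreflpD transpD)+
  have three: "m = [] \<or> m = [c] \<or> m = [d] \<or> m = [e] \<or> m = [c, d] \<or> m = [c, e] \<or> m = [d, e] \<or> m = [c, d, e]"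
    if "subseq m [c, d, e]" for m and c d e :: nat
  proof -
    have "m \<in> set (subseqs [c, d, e])" using that unfolding set_subseqs_eq by simp
    then show ?thesis by (simp add: Let_def del: set_subseqs_eq) auto
  qed
  show "has_chain R k (u @ [y, a, b] @ v) \<Longrightarrow> has_chain R k (u @ [y, b, a] @ v)"
  proof (erule key)
    fix m assume m: "subseq m [y, a, b]" "sorted_wrt R m"
    show "subseq m [y, b, a] \<or> (m = [a, b] \<and> (subseq [y, b] [y, b, a] \<or> subseq [a, y] [y, b, a]))"
      using three[OF m(1)] m(2) no by auto
  qed
  show "has_chain R k (u @ [a, b, y] @ v) \<Longrightarrow> has_chain R k (u @ [b, a, y] @ v)"
  proof (erule key)
    fix m assume m: "subseq m [a, b, y]" "sorted_wrt R m"
    show "subseq m [b, a, y] \<or> (m = [a, b] \<and> (subseq [y, b] [b, a, y] \<or> subseq [a, y] [b, a, y]))"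
      using three[OF m(1)] m(2) no by auto
  qed
qed

text \<open>Both elementary relations are stated symmetrically in \<open>x\<close> and \<open>z\<close>, so that the relation is
  its own converse.\<close>

inductive knuth_step :: "nat list \<Rightarrow> nat list \<Rightarrow> bool" where
  left: "x < y \<and> y < z \<or> z < y \<and> y < x \<Longrightarrow> knuth_step (u @ [y, x, z] @ v) (u @ [y, z, x] @ v)"
| right: "x < y \<and> y < z \<or> z < y \<and> y < x \<Longrightarrow> knuth_step (u @ [x, z, y] @ v) (u @ [z, x, y] @ v)"

abbreviation knuth :: "nat list \<Rightarrow> nat list \<Rightarrow> bool" (infix "\<approx>\<^sub>K" 50) where
  "knuth \<equiv> knuth_step\<^sup>*\<^sup>*"

lemma knuth_step_sym: "knuth_step v w \<Longrightarrow> knuth_step w v"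
  by (induction rule: knuth_step.induct) (blast intro: knuth_step.intros)+

text \<open>In either orientation of a step, \<open>R x z\<close> forces \<open>y\<close> to lie
  between \<open>x\<close> and \<open>z\<close>, so the swap lemma applies; the symmetry of steps
  turns the implication into an equivalence.\<close>

lemma knuth_has_chain:
  assumes "v \<approx>\<^sub>K w" and R: "R = (<) \<or> R = (>)"
  shows "has_chain R k v \<longleftrightarrow> has_chain R k w"
proof -
  have T: "transp R" "irreflp R" using R by (auto simp: transp_def irreflp_def)
  have "has_chain R k v \<Longrightarrow> has_chain R k w" if "knuth_step v w" for v w
    using that
  proof cases
    case (left x y z u v')
    then have "R x z \<Longrightarrow> R x y \<and> R y z" using R by auto
    with has_chain_swap(1)[OF T] left show "has_chain R k v \<Longrightarrow> has_chain R k w" by blast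
  next
    case (right x y z u v')
    then have "R x z \<Longrightarrow> R x y \<and> R y z" using R by auto
    with has_chain_swap(2)[OF T] right show "has_chain R k v \<Longrightarrow> has_chain R k w" by blast
  qed
  then have "has_chain R k v \<longleftrightarrow> has_chain R k w" if "knuth_step v w" for v w
    using that knuth_step_sym by blast
  with assms(1) show ?thesis by (induction rule: rtranclp_induct) auto
qed

lemma knuth_step_append: "knuth_step v w \<Longrightarrow> knuth_step (p @ v @ q) (p @ w @ q)"
proof (induction rule: knuth_step.induct)
  case (left x y z u v)
  then show ?case using knuth_step.left[of x y z "p @ u" "v @ q"] by simp
next
  case (right x y z u v)
  then show ?case using knuth_step.right[of x y z "p @ u" "v @ q"] by simp
qed

lemma knuth_append: "v \<approx>\<^sub>K w \<Longrightarrow> p @ v @ q \<approx>\<^sub>K p @ w @ q"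
  by (induction rule: rtranclp_induct) (auto intro: rtranclp.rtrancl_into_rtrancl knuth_step_append)

text \<open>\<open>x\<close> passes the entries of \<open>r\<close> from the right, and the left
  neighbour of the entry being passed is the middle value of the elementary relation.\<close>

lemma knuth_move_left:
  "sorted_wrt (<) (a # r) \<Longrightarrow> x < a \<Longrightarrow> (a # r) @ [x] \<approx>\<^sub>K a # x # r"
proof (induction r arbitrary: a)
  case (Cons b r)
  have "(b # r) @ [x] \<approx>\<^sub>K b # x # r" using Cons by auto
  then have "(a # b # r) @ [x] \<approx>\<^sub>K [a, b, x] @ r"
    using knuth_append[of "(b # r) @ [x]" "b # x # r" "[a]" "[]"] by simp
  moreover have "knuth_step ([] @ [a, b, x] @ r) ([] @ [a, x, b] @ r)"
    using Cons.prems by (intro knuth_step.left) auto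
  ultimately show ?case by simp
qed simp

text \<open>Inside the word, \<open>x\<close> travels left until it stands right of the entry
  \<open>y\<close> it bumps; then \<open>y\<close> travels left to the front.\<close>

lemma knuth_row_ins:
  "row_ins x r = (r', Some y) \<Longrightarrow> sorted_wrt (<) r \<Longrightarrow> x \<notin> set r \<Longrightarrow> r @ [x] \<approx>\<^sub>K y # r'"
proof (induction r arbitrary: r')
  case (Cons a r)
  show ?case
  proof (cases "x < a")
    case True
    then show ?thesis using knuth_move_left[of a r x] Cons.prems by auto
  next
    case False
    then obtain r1 where r1: "row_ins x r = (r1, Some y)" "r' = a # r1"
      using Cons.prems by (auto split: prod.splits)
    have s1: "sorted_wrt (<) r1" using row_ins_sorted[OF r1(1)] Cons.prems by auto
    note R = row_ins_Some[OF r1(1)]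
    have ss: "set r1 \<subseteq> insert x (set r)" using R by auto
    obtain c r2 where c: "r1 = c # r2" using R by (cases r1) auto
    have "a < c" using ss c Cons.prems False by auto
    moreover have "c < y" using R s1 c by auto
    \<comment> \<open>\<open>y\<close> passes the smaller entry \<open>a\<close>; the middle value
      is \<open>c\<close>, the entry that follows \<open>a\<close> after the insertion.\<close>
    ultimately have "knuth_step ([] @ [a, y, c] @ r2) ([] @ [y, a, c] @ r2)"
      by (intro knuth_step.right) auto
    moreover have "r @ [x] \<approx>\<^sub>K y # r1" using Cons r1 by auto
    then have "[a] @ (r @ [x]) @ [] \<approx>\<^sub>K [a] @ (y # r1) @ []" by (rule knuth_append)
    ultimately show ?thesis using r1 c by simp
  qed
qed simp

section \<open>Reading words and the lengths of longest chains\<close>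

lemma subseq_sorted_wrt: "subseq s t \<Longrightarrow> sorted_wrt R t \<Longrightarrow> sorted_wrt R s"
  by (induction rule: list_emb.induct) (auto dest: list_emb_set)

text \<open>Row reading word, bottom row first. In this order a bumped entry comes to stand directly
  after the word of the lower rows, where its insertion into them continues.\<close>

definition reading :: "nat list list \<Rightarrow> nat list" where
  "reading T = concat (rev T)"

lemma reading_simps [simp]: "reading [] = []" "reading (r # T) = reading T @ r"
  by (simp_all add: reading_def)

lemma reading_ins:
  "is_tableau T \<Longrightarrow> distinct (concat T) \<Longrightarrow> x \<notin> entries T \<Longrightarrow> reading T @ [x] \<approx>\<^sub>K reading (ins x T)"
proof (induction T arbitrary: x)
  case (Cons r T)
  obtain r' b where rb: "row_ins x r = (r', b)" by fastforce
  show ?case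
  proof (cases b)
    case None
    with row_ins_None[of x r r'] rb show ?thesis by simp
  next
    case (Some y)
    have "y \<in> set r" using row_ins_Some[of x r r' y] rb Some by auto
    then have 1: "reading T @ [y] \<approx>\<^sub>K reading (ins y T)" using Cons by auto
    have "r @ [x] \<approx>\<^sub>K y # r'" using knuth_row_ins[of x r r' y] rb Some Cons.prems by auto
    then have "reading T @ (r @ [x]) @ [] \<approx>\<^sub>K reading T @ (y # r') @ []" by (rule knuth_append)
    also have "reading T @ (y # r') @ [] = [] @ (reading T @ [y]) @ r'" by simp
    also have "[] @ (reading T @ [y]) @ r' \<approx>\<^sub>K [] @ reading (ins y T) @ r'"
      using 1 by (rule knuth_append)
    finally show ?thesis using rb Some by simp
  qed
qed simp

definition insertion_tableau :: "nat list \<Rightarrow> nat list list" where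
  "insertion_tableau w = foldl (\<lambda>T x. ins x T) [] w"

lemma insertion_tableau_simps [simp]:
  "insertion_tableau [] = []" "insertion_tableau (w @ [x]) = ins x (insertion_tableau w)"
  by (simp_all add: insertion_tableau_def)

lemma insertion_tableau:
  "distinct w \<Longrightarrow> is_tableau (insertion_tableau w) \<and> distinct (concat (insertion_tableau w)) \<and>
     entries (insertion_tableau w) = set w \<and> w \<approx>\<^sub>K reading (insertion_tableau w)"
proof (induction w rule: rev_induct)
  case (snoc x w)
  let ?T = "insertion_tableau w"
  from snoc have I: "is_tableau ?T" "distinct (concat ?T)" "entries ?T = set w" "w \<approx>\<^sub>K reading ?T" by auto
  have "[] @ w @ [x] \<approx>\<^sub>K [] @ reading ?T @ [x]" using I(4) by (rule knuth_append)
  moreover have x: "x \<notin> entries ?T" using I(3) snoc.prems by simp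
  ultimately have "w @ [x] \<approx>\<^sub>K reading (ins x ?T)" using reading_ins[OF I(1,2) x] by simp
  then show ?case using is_tableau_ins[OF I(1,2) x] entries_ins[OF I(1,2) x] I(3) by simp
qed simp

text \<open>A decreasing subsequence takes at most one entry from each increasing row; the first
  column, read upwards, attains the bound.\<close>

lemma decreasing_chain_reading:
  assumes "is_tableau T" "distinct (concat T)"
  shows "has_chain (>) k (reading T) \<longleftrightarrow> k \<le> length T"
proof
  have "length s \<le> length T" if "subseq s (reading T)" "sorted_wrt (>) s" for s
    using that assms
  proof (induction T arbitrary: s)
    case (Cons r T)
    have "subseq s (reading T @ r)" using Cons.prems by simp
    then obtain s1 s2 where s: "s = s1 @ s2" "subseq s1 (reading T)" "subseq s2 r"
      by (rule subseq_appendE)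
    have "sorted_wrt (<) s2" using s(3) Cons.prems subseq_sorted_wrt by auto
    moreover have "sorted_wrt (>) s2" using s(1) Cons.prems by (simp add: sorted_wrt_append)
    ultimately have "length s2 \<le> 1" by (cases s2 rule: list.exhaust; cases "tl s2") auto
    moreover have "length s1 \<le> length T" using Cons s by (auto simp: sorted_wrt_append)
    ultimately show ?case using s by simp
  qed simp
  then show "has_chain (>) k (reading T) \<Longrightarrow> k \<le> length T" by (auto simp: has_chain_def)
next
  assume k: "k \<le> length T"
  have "subseq (rev (map hd T)) (reading T) \<and> sorted_wrt (<) (map hd T)"
    using assms
  proof (induction T)
    case (Cons r T)
    have "hd r < hd s" if "s \<in> set T" for s
    proof -
      have T: "T \<noteq> []" using that by auto
      have "hd r < hd (hd T)" using Cons.prems T by (cases r; cases T; cases "hd T") auto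
      moreover have "hd (hd T) \<le> hd s" using Cons that T by (cases T) auto
      ultimately show ?thesis by simp
    qed
    moreover have "subseq [hd r] r" using Cons.prems by (cases r) auto
    ultimately show ?case using Cons by (auto intro: list_emb_append_mono)
  qed simp
  then have "subseq (rev (map hd T)) (reading T)" "sorted_wrt (>) (rev (map hd T))"
    by (auto simp: sorted_wrt_rev)
  moreover have "subseq (take k (rev (map hd T))) (rev (map hd T))"
    by (simp add: prefix_imp_subseq take_is_prefix)
  ultimately have "subseq (take k (rev (map hd T))) (reading T)" "sorted_wrt (>) (take k (rev (map hd T)))"
    using subseq_order.trans by (blast, metis sorted_wrt_take)
  then show "has_chain (>) k (reading T)"
    using k unfolding has_chain_def by (intro exI[of _ "take k (rev (map hd T))"]) auto
qed

lemma column_dominates_filter: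
  "column_dominates r s \<Longrightarrow> length (filter (\<lambda>u. u \<le> v) s) \<le> length (filter (\<lambda>u. u \<le> (v::nat)) r)"
  by (induction r s rule: column_dominates.induct) auto

text \<open>The bound \<open>v\<close> makes the induction over the rows work: the part of the chain in the lower rows is
  bounded by its largest element.\<close>

lemma increasing_chain_bound:
  "is_tableau T \<Longrightarrow> T \<noteq> [] \<Longrightarrow> subseq s (reading T) \<Longrightarrow> sorted_wrt (<) s \<Longrightarrow> \<forall>u\<in>set s. u \<le> v \<Longrightarrow>
   length s \<le> length (filter (\<lambda>u. u \<le> v) (hd T))"
proof (induction T arbitrary: s v)
  case (Cons r T)
  have "subseq s (reading T @ r)" using Cons.prems by simp
  then obtain s1 s2 where s: "s = s1 @ s2" "subseq s1 (reading T)" "subseq s2 r"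
    by (rule subseq_appendE)
  show ?case
  proof (cases "s1 = []")
    case True
    have "subseq (filter (\<lambda>u. u \<le> v) s2) (filter (\<lambda>u. u \<le> v) r)"
      using s by (simp add: subseq_filter)
    moreover have "filter (\<lambda>u. u \<le> v) s2 = s2" using Cons.prems s by (auto simp: filter_id_conv)
    ultimately show ?thesis using s True list_emb_length by fastforce
  next
    case False
    define v1 where "v1 = last s1"
    have T: "T \<noteq> []" using False s by auto
    have v1: "v1 \<le> v" "\<forall>u\<in>set s2. v1 < u" "sorted_wrt (<) s1"
      using Cons.prems s False by (auto simp: v1_def sorted_wrt_append)
    have le: "\<forall>u\<in>set s1. u \<le> v1"
    proof
      fix u assume u: "u \<in> set s1"
      have "s1 = butlast s1 @ [v1]" using False by (simp add: v1_def)
      then have "sorted_wrt (<) (butlast s1 @ [v1])" "u \<in> set (butlast s1 @ [v1])"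
        using v1(3) u by simp_all
      then show "u \<le> v1" by (auto simp: sorted_wrt_append)
    qed
    have "length s1 \<le> length (filter (\<lambda>u. u \<le> v1) (hd T))"
      using Cons.IH[OF _ T s(2) v1(3) le] Cons.prems by simp
    also have "\<dots> \<le> length (filter (\<lambda>u. u \<le> v1) r)"
      using Cons.prems T by (intro column_dominates_filter) auto
    finally have 1: "length s1 \<le> length (filter (\<lambda>u. u \<le> v1) r)" .
    have "subseq (filter (\<lambda>u. v1 < u \<and> u \<le> v) s2) (filter (\<lambda>u. v1 < u \<and> u \<le> v) r)"
      using s by (simp add: subseq_filter)
    moreover have "filter (\<lambda>u. v1 < u \<and> u \<le> v) s2 = s2"
      using Cons.prems s v1 by (auto simp: filter_id_conv)
    ultimately have 2: "length s2 \<le> length (filter (\<lambda>u. v1 < u \<and> u \<le> v) r)"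
      using list_emb_length by fastforce
    \<comment> \<open>The part of the chain in lower rows is charged to entries of \<open>r\<close>
      up to \<open>v1\<close>, the part in \<open>r\<close> to entries above \<open>v1\<close> and
      up to \<open>v\<close>; these ranges are disjoint.\<close>
    have "length (filter (\<lambda>u. u \<le> v1) q) + length (filter (\<lambda>u. v1 < u \<and> u \<le> v) q)
        \<le> length (filter (\<lambda>u. u \<le> v) q)" for q
      using v1(1) by (induction q) auto
    from this[of r] 1 2 s show ?thesis by simp
  qed
qed simp

lemma increasing_chain_reading:
  assumes "is_tableau T" "T \<noteq> []"
  shows "has_chain (<) k (reading T) \<longleftrightarrow> k \<le> length (hd T)"
proof
  assume "has_chain (<) k (reading T)"
  then obtain s where s: "subseq s (reading T)" "sorted_wrt (<) s" "length s = k"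
    by (auto simp: has_chain_def)
  \<comment> \<open>For empty \<open>s\<close> the value of \<open>Max\<close> is arbitrary, but
    then the bound on the elements of \<open>s\<close> is vacuous.\<close>
  have "length s \<le> length (filter (\<lambda>u. u \<le> Max (set s)) (hd T))"
    by (rule increasing_chain_bound[OF assms s(1,2)]) simp
  then show "k \<le> length (hd T)" using s(3) length_filter_le le_trans by metis
next
  assume k: "k \<le> length (hd T)"
  have "subseq (hd T) (reading T)" "sorted_wrt (<) (hd T)" using assms by (cases T; auto)+
  moreover have "subseq (take k (hd T)) (hd T)" by (simp add: prefix_imp_subseq take_is_prefix)
  ultimately have "subseq (take k (hd T)) (reading T)" "sorted_wrt (<) (take k (hd T))"
    using subseq_order.trans by (blast, metis sorted_wrt_take)
  then show "has_chain (<) k (reading T)"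
    using k unfolding has_chain_def by (intro exI[of _ "take k (hd T)"]) auto
qed

lemma has_chain_Nil: "has_chain R k [] \<longleftrightarrow> k = 0"
proof -
  have "subseq s [] \<longleftrightarrow> s = []" for s :: "nat list" using list_emb_Nil2[of "(=)" s] by auto
  then show ?thesis by (auto simp: has_chain_def)
qed

text \<open>Schensted's theorem phrased by single cells of the first column and the first row, which
  transposition exchanges. The case \<open>k = 0\<close> is separate because of the index
  \<open>k - 1\<close>.\<close>

lemma chain_insertion_tableau:
  assumes "distinct w"
  shows "has_chain (>) k w \<longleftrightarrow> k = 0 \<or> (k - 1, 0) \<in> cells (insertion_tableau w)"
    and "has_chain (<) k w \<longleftrightarrow> k = 0 \<or> (0, k - 1) \<in> cells (insertion_tableau w)"
proof -
  let ?T = "insertion_tableau w"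
  have T: "is_tableau ?T" "distinct (concat ?T)" "w \<approx>\<^sub>K reading ?T" using insertion_tableau[OF assms] by auto
  have "i < length ?T \<Longrightarrow> ?T ! i \<noteq> []" for i using T(1)
  proof -
    have "is_tableau U \<Longrightarrow> i < length U \<Longrightarrow> U ! i \<noteq> []" for U
      by (induction U arbitrary: i) (auto simp: nth_Cons split: nat.splits)
    then show "i < length ?T \<Longrightarrow> ?T ! i \<noteq> []" using T(1) by blast
  qed
  then have "k \<le> length ?T \<longleftrightarrow> k = 0 \<or> (k - 1, 0) \<in> cells ?T"
    by (cases k) (auto simp: cells_def)
  then show "has_chain (>) k w \<longleftrightarrow> k = 0 \<or> (k - 1, 0) \<in> cells ?T"
    using knuth_has_chain[OF T(3)] decreasing_chain_reading[OF T(1,2)] by simp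
  show "has_chain (<) k w \<longleftrightarrow> k = 0 \<or> (0, k - 1) \<in> cells ?T"
  proof (cases "?T = []")
    case True
    then show ?thesis using knuth_has_chain[OF T(3), of "(<)" k] has_chain_Nil by simp
  next
    case False
    have "k \<le> length (hd ?T) \<longleftrightarrow> k = 0 \<or> (0, k - 1) \<in> cells ?T"
      using False by (cases k; cases ?T) (auto simp: cells_def)
    then show ?thesis using knuth_has_chain[OF T(3)] increasing_chain_reading[OF T(1) False] by simp
  qed
qed

section \<open>Matchings and their sequences of shapes\<close>

text \<open>The position of \<open>m\<close> shows which cell to remove. Non-empty rows matter:
  \<open>[]\<close> and \<open>[[]]\<close> would both become \<open>[[m]]\<close>.\<close>

lemma add_cell_cancel:
  "add_cell m i T = add_cell m j U \<Longrightarrow> is_tableau T \<Longrightarrow> is_tableau U \<Longrightarrow> m \<notin> entries T \<Longrightarrow> m \<notin> entries U \<Longrightarrow> T = U"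
proof (induction T arbitrary: i j U)
  case Nil
  then show ?case by (cases U; cases j) auto
next
  case (Cons r T)
  show ?case
  proof (cases U)
    case Nil
    with Cons.prems show ?thesis by (cases i) auto
  next
    case U: (Cons s V)
    show ?thesis
    proof (cases i; cases j)
      fix i' j' assume "i = Suc i'" "j = Suc j'"
      then show ?thesis using Cons.IH[of i' j' V] Cons.prems U by auto
    qed (use Cons.prems U in auto)
  qed
qed

text \<open>When inserted, \<open>m\<close> ends the first row, and by \<open>ins_add_cell\<close>
  every later insertion only changes its row index.\<close>

lemma insertion_tableau_delete_max:
  assumes "\<forall>x\<in>set (u @ v). x < m" "distinct (u @ v)"
  shows "\<exists>i. insertion_tableau (u @ [m] @ v) = add_cell m i (insertion_tableau (u @ v))"
  using assms
proof (induction v rule: rev_induct)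
  case Nil
  then have "\<forall>y\<in>entries (insertion_tableau u). y < m" using insertion_tableau[of u] by simp
  then show ?case using ins_max[of "insertion_tableau u" m] by (intro exI[of _ 0]) simp
next
  case (snoc x v)
  have d: "distinct (u @ v)" using snoc.prems by auto
  obtain i where i: "insertion_tableau (u @ [m] @ v) = add_cell m i (insertion_tableau (u @ v))"
    using snoc by auto
  have "\<forall>y\<in>entries (insertion_tableau (u @ v)). y < m"
    using insertion_tableau[OF d] snoc.prems by auto
  then obtain i' where i': "ins x (add_cell m i (insertion_tableau (u @ v))) =
      add_cell m i' (ins x (insertion_tableau (u @ v)))"
    using ins_add_cell[of "insertion_tableau (u @ v)" m x i] snoc.prems by auto
  then show ?case
    using insertion_tableau_simps(2)[of "u @ [m] @ v" x] insertion_tableau_simps(2)[of "u @ v" x]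
    unfolding i i' by (intro exI[of _ i']) (simp del: insertion_tableau_simps)
qed

locale endpoints =
  fixes N :: nat and Op Cl :: "nat set"
  assumes disjoint: "Op \<inter> Cl = {}" and closers: "Cl \<subseteq> {..<N}"
begin

text \<open>Directed from closers to openers because it is at a closer that an opener is inserted.
  Extensionality makes matchings equal as functions when they agree on \<open>Cl\<close>, which
  injectivity statements require.\<close>

definition matchings :: "(nat \<Rightarrow> nat) set" where
  "matchings = {f \<in> extensional Cl. bij_betw f Cl Op \<and> (\<forall>b\<in>Cl. f b < b)}"

text \<open>The openers of the arcs that straddle position \<open>t\<close>, in decreasing order of their closers: a
  decreasing subsequence is a crossing, an increasing one a nesting.\<close>

definition open_word :: "(nat \<Rightarrow> nat) \<Rightarrow> nat \<Rightarrow> nat list" where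
  "open_word f t = map f (filter (\<lambda>b. b \<in> Cl \<and> f b < t) (rev [t..<N]))"

abbreviation tableau_at :: "(nat \<Rightarrow> nat) \<Rightarrow> nat \<Rightarrow> nat list list" where
  "tableau_at f t \<equiv> insertion_tableau (open_word f t)"

lemma open_word_end: "N \<le> t \<Longrightarrow> open_word f t = []"
  by (simp add: open_word_def)

lemma open_word_0: "open_word f 0 = []"
  by (simp add: open_word_def)

lemma set_open_word: "x \<in> set (open_word f t) \<Longrightarrow> x < t"
  by (auto simp: open_word_def)

lemma distinct_open_word: "f \<in> matchings \<Longrightarrow> distinct (open_word f t)"
  unfolding open_word_def matchings_def bij_betw_def
  by (auto simp: distinct_map intro: inj_on_subset)

lemmas tableau_at = insertion_tableau[OF distinct_open_word]

lemma entries_tableau_at: "f \<in> matchings \<Longrightarrow> \<forall>x\<in>entries (tableau_at f t). x < t"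
  using tableau_at[of f t] set_open_word by simp

lemma filter_rev_upt_Suc:
  "t < N \<Longrightarrow> filter P (rev [t..<N]) = filter P (rev [Suc t..<N]) @ filter P [t]"
  by (simp add: upt_conv_Cons)

text \<open>\<open>t\<close> is the smallest closer among the straddling arcs, so its opener comes
  last; as \<open>t\<close> is no opener, the bounds \<open>t\<close> and \<open>Suc t\<close> admit
  the same arcs.\<close>

lemma open_word_closer:
  assumes f: "f \<in> matchings" and t: "t \<in> Cl"
  shows "open_word f t = open_word f (Suc t) @ [f t]"
proof -
  have "t < N" using t closers by auto
  have ne: "f b \<noteq> t" if "b \<in> Cl" for b
    using f t that disjoint by (auto simp: matchings_def bij_betw_def)
  have "filter (\<lambda>b. b \<in> Cl \<and> f b < t) L = filter (\<lambda>b. b \<in> Cl \<and> f b < Suc t) L" for L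
    using ne by (intro filter_cong) (auto simp: less_Suc_eq)
  moreover have "f t < t" using f t by (auto simp: matchings_def)
  ultimately show ?thesis
    using t by (simp add: open_word_def filter_rev_upt_Suc[OF \<open>t < N\<close>] del: rev_append)
qed

lemma open_word_other:
  assumes f: "f \<in> matchings" and t: "t \<notin> Cl" "t \<notin> Op"
  shows "open_word f (Suc t) = open_word f t"
proof (cases "t < N")
  case True
  have ne: "f b \<noteq> t" if "b \<in> Cl" for b
    using f t that by (auto simp: matchings_def bij_betw_def)
  have "filter (\<lambda>b. b \<in> Cl \<and> f b < t) L = filter (\<lambda>b. b \<in> Cl \<and> f b < Suc t) L" for L
    using ne by (intro filter_cong) (auto simp: less_Suc_eq)
  then show ?thesis using t by (simp add: open_word_def filter_rev_upt_Suc[OF True] del: rev_append)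
qed (simp add: open_word_end)

text \<open>The letter \<open>t\<close> is the largest, but its place in the word is decided by its
  closer and can be anywhere; hence the two factors \<open>u\<close> and \<open>v\<close>.\<close>

lemma open_word_opener:
  assumes f: "f \<in> matchings" and t: "t \<in> Op"
  shows "\<exists>u v. open_word f (Suc t) = u @ [t] @ v \<and> open_word f t = u @ v"
proof -
  obtain b where b: "b \<in> Cl" "f b = t" using f t by (auto simp: matchings_def bij_betw_def)
  have bt: "t < b" using f b by (auto simp: matchings_def)
  have bN: "b < N" using b closers by auto
  have "t \<notin> Cl" using t disjoint by auto
  have "b \<in> set (rev [Suc t..<N])" using bt bN by auto
  then obtain L1 L2 where L: "rev [Suc t..<N] = L1 @ b # L2" by (meson split_list)
  have "distinct (rev [Suc t..<N])" by simp
  then have nb: "b \<notin> set L1" "b \<notin> set L2" unfolding L by auto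
  have eq: "filter (\<lambda>c. c \<in> Cl \<and> f c < Suc t) M = filter (\<lambda>c. c \<in> Cl \<and> f c < t) M"
    if "b \<notin> set M" for M
  proof (intro filter_cong refl)
    fix c assume "c \<in> set M"
    then have "c \<noteq> b" using that by auto
    then have "c \<in> Cl \<Longrightarrow> f c \<noteq> t" using f b by (auto simp: matchings_def bij_betw_def inj_on_def)
    then show "(c \<in> Cl \<and> f c < Suc t) = (c \<in> Cl \<and> f c < t)" by (auto simp: less_Suc_eq)
  qed
  let ?F = "\<lambda>M. map f (filter (\<lambda>c. c \<in> Cl \<and> f c < t) M)"
  have "open_word f (Suc t) = ?F L1 @ [t] @ ?F L2"
    unfolding open_word_def L using b nb eq by simp
  moreover have "open_word f t = ?F L1 @ ?F L2"
  proof -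
    have "t < N" using bt bN by simp
    show ?thesis
      unfolding open_word_def filter_rev_upt_Suc[OF \<open>t < N\<close>] L using b \<open>t \<notin> Cl\<close> by simp
  qed
  ultimately show ?thesis by blast
qed

lemma tableau_at_closer:
  assumes f: "f \<in> matchings" and t: "t \<in> Cl"
  shows "tableau_at f t = ins (f t) (tableau_at f (Suc t))"
  by (simp add: open_word_closer[OF assms])

lemma tableau_at_opener:
  assumes f: "f \<in> matchings" and t: "t \<in> Op"
  shows "\<exists>i. tableau_at f (Suc t) = add_cell t i (tableau_at f t)"
proof -
  obtain u v where uv: "open_word f (Suc t) = u @ [t] @ v" "open_word f t = u @ v"
    using open_word_opener[OF assms] by blast
  have "\<forall>x\<in>set (u @ v). x < t" using set_open_word[of _ f t] uv by simp
  moreover have "distinct (u @ v)" using distinct_open_word[OF f, of t] uv by simp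
  ultimately show ?thesis using insertion_tableau_delete_max uv by simp
qed

lemma tableau_at_other:
  "f \<in> matchings \<Longrightarrow> t \<notin> Cl \<Longrightarrow> t \<notin> Op \<Longrightarrow> tableau_at f (Suc t) = tableau_at f t"
  by (simp add: open_word_other)

text \<open>Going from left to right, starting with the empty tableau, each step is forced. At a
  closer the shapes fix the corner where reverse insertion begins, which also yields the opener; at
  an opener they fix the cell of the new entry \<open>t\<close>.\<close>

lemma matching_determined_by_shapes:
  assumes f: "f \<in> matchings" and g: "g \<in> matchings"
    and eq: "\<And>t. cells (tableau_at f t) = cells (tableau_at g t)"
  shows "f = g"
proof -
  have ml: "map length (tableau_at f t) = map length (tableau_at g t)" for t
    using cells_eq_map_length eq tableau_at[OF f] tableau_at[OF g] by blast
  have closer: "f t = g t \<and> tableau_at f (Suc t) = tableau_at g (Suc t)"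
    if "t \<in> Cl" "tableau_at f t = tableau_at g t" for t
    using that ins_inj[OF _ ml[of "Suc t"]] tableau_at[OF f, of "Suc t"] tableau_at[OF g, of "Suc t"]
    by (simp add: tableau_at_closer[OF f] tableau_at_closer[OF g])
  have all: "tableau_at f t = tableau_at g t" for t
  proof (induction t)
    case 0
    show ?case by (simp add: open_word_0)
  next
    case (Suc t)
    consider "t \<in> Cl" | "t \<in> Op" | "t \<notin> Cl" "t \<notin> Op" by blast
    then show ?case
    proof cases
      case 1 then show ?thesis using closer Suc by blast
    next
      case 2
      then obtain i j where i: "tableau_at f (Suc t) = add_cell t i (tableau_at f t)"
        and j: "tableau_at g (Suc t) = add_cell t j (tableau_at g t)"
        using tableau_at_opener f g by blast
      then show ?thesis using add_cell_inj[of t i "tableau_at f t" j] ml[of "Suc t"] Suc by simp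
    next
      case 3 then show ?thesis using tableau_at_other f g Suc by simp
    qed
  qed
  show ?thesis
  proof (rule extensionalityI[of f Cl g])
    show "f \<in> extensional Cl" "g \<in> extensional Cl" using f g by (auto simp: matchings_def)
    show "f x = g x" if "x \<in> Cl" for x using closer[OF that all] by simp
  qed
qed

section \<open>Realising the transposed shapes by a matching\<close>

lemma down_closed_swap: "down_closed A \<Longrightarrow> down_closed (prod.swap ` A)"
  unfolding down_closed_def by (metis (no_types, opaque_lifting) imageE image_eqI prod.swap_def prod.sel swap_swap)

text \<open>Tableaux \<open>U t\<close> of the transposed shapes \<open>Z t\<close> are built from
  left to right, and \<open>g\<close> sends a closer to the entry ejected there. It remains to see
  that \<open>g\<close> is a bijection onto the openers and that insertion along \<open>g\<close>
  reproduces the \<open>U t\<close>.\<close>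

lemma transposed_matching_exists:
  assumes f: "f \<in> matchings"
  shows "\<exists>g\<in>matchings. \<forall>t. cells (tableau_at g t) = prod.swap ` cells (tableau_at f t)"
proof -
  define Z where "Z t = prod.swap ` cells (tableau_at f t)" for t
  have Z0: "Z 0 = {}" by (simp add: Z_def open_word_0)
  have ZN: "Z t = {}" if "N \<le> t" for t using that by (simp add: Z_def open_word_end)
  have Zy: "down_closed (Z t)" for t
    unfolding Z_def using down_closed_swap down_closed_cells tableau_at[OF f] by blast
  have ins_swap: "\<exists>c. c \<notin> prod.swap ` B \<and> prod.swap ` A = insert c (prod.swap ` B)"
    if "\<exists>c. c \<notin> B \<and> A = insert c B" for A B :: "(nat \<times> nat) set"
  proof -
    from that obtain c where "c \<notin> B" "A = insert c B" by blast
    then show ?thesis by (intro exI[of _ "prod.swap c"]) (auto simp: inj_image_mem_iff)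
  qed
  have ZC: "\<exists>c. c \<notin> Z (Suc t) \<and> Z t = insert c (Z (Suc t))" if "t \<in> Cl" for t
    unfolding Z_def tableau_at_closer[OF f that] by (rule ins_swap) (rule cells_ins)
  have ZO: "\<exists>c. c \<notin> Z t \<and> Z (Suc t) = insert c (Z t)" if t: "t \<in> Op" for t
  proof -
    obtain i where "tableau_at f (Suc t) = add_cell t i (tableau_at f t)"
      using tableau_at_opener[OF f t] by blast
    then show ?thesis unfolding Z_def by (metis ins_swap cells_add_cell)
  qed
  have Zn: "Z (Suc t) = Z t" if "t \<notin> Cl" "t \<notin> Op" for t
    unfolding Z_def using tableau_at_other[OF f that] by simp
  define P where "P t U \<longleftrightarrow> is_tableau U \<and> distinct (concat U) \<and> cells U = Z t \<and> (\<forall>x\<in>entries U. x < t)" for t U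
  define Q where "Q t U V \<longleftrightarrow>
     (t \<in> Cl \<longrightarrow> (\<exists>a. ins a V = U \<and> a \<notin> entries V \<and> entries U = insert a (entries V))) \<and>
     (t \<in> Op \<longrightarrow> (\<exists>i. V = add_cell t i U)) \<and> (t \<notin> Cl \<and> t \<notin> Op \<longrightarrow> V = U)" for t U V
  \<comment> \<open>No step can fail: at a closer the lost cell is a corner, so reverse insertion
    applies; at an opener the gained cell can hold \<open>t\<close> because all present entries are
    smaller.\<close>
  have "\<exists>U. \<forall>t. P t (U t) \<and> Q t (U t) (U (Suc t))"
  proof (rule dependent_nat_choice)
    show "\<exists>U. P 0 U" by (rule exI[of _ "[]"]) (simp add: P_def Z0)
  next
    fix U t assume PU: "P t U"
    have "t \<in> Op \<Longrightarrow> t \<notin> Cl" using disjoint by auto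
    then consider "t \<in> Cl" "t \<notin> Op" | "t \<in> Op" "t \<notin> Cl" | "t \<notin> Cl" "t \<notin> Op" by blast
    then show "\<exists>V. P (Suc t) V \<and> Q t U V"
    proof cases
      case 1
      then obtain c where c: "c \<notin> Z (Suc t)" "Z t = insert c (Z (Suc t))" using ZC by blast
      then have "cells U - {c} = Z (Suc t)" "c \<in> cells U" using PU by (auto simp: P_def)
      then obtain a V where "is_tableau V" "ins a V = U" "cells V = Z (Suc t)" "distinct (concat V)"
          "a \<notin> entries V" "entries U = insert a (entries V)"
        using ins_exists[of U c] Zy[of "Suc t"] PU unfolding P_def by metis
      then have "P (Suc t) V \<and> Q t U V"
        using PU 1 unfolding P_def Q_def by (auto simp: less_Suc_eq)
      then show ?thesis ..
    next
      case 2
      then obtain c where c: "c \<notin> Z t" "Z (Suc t) = insert c (Z t)" using ZO by blast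
      then have "c \<notin> cells U" "down_closed (insert c (cells U))" using Zy[of "Suc t"] PU by (auto simp: P_def)
      then obtain i where i: "is_tableau (add_cell t i U)" "cells (add_cell t i U) = insert c (cells U)"
        using add_cell_exists[of U c t] PU unfolding P_def by blast
      have "distinct (concat (add_cell t i U))"
        using PU by (intro entries_add_cell) (auto simp: P_def)
      then have "P (Suc t) (add_cell t i U) \<and> Q t U (add_cell t i U)"
        using PU i c 2 unfolding P_def Q_def by (auto simp: entries_add_cell(1) less_Suc_eq simp del: set_concat)
      then show ?thesis ..
    next
      case 3
      then have "P (Suc t) U \<and> Q t U U" using PU Zn unfolding P_def Q_def by (auto simp: less_Suc_eq)
      then show ?thesis ..
    qed
  qed
  then obtain U where U: "\<And>t. P t (U t)" "\<And>t. Q t (U t) (U (Suc t))" by blast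
  have "\<forall>t\<in>Cl. \<exists>a. ins a (U (Suc t)) = U t \<and> a \<notin> entries (U (Suc t)) \<and> entries (U t) = insert a (entries (U (Suc t)))"
    using U(2) unfolding Q_def by blast
  then obtain h where h: "\<forall>t\<in>Cl. ins (h t) (U (Suc t)) = U t \<and> h t \<notin> entries (U (Suc t)) \<and>
      entries (U t) = insert (h t) (entries (U (Suc t)))" by (metis bchoice)
  define g where "g = restrict h Cl"
  have g: "ins (g t) (U (Suc t)) = U t" "g t \<notin> entries (U (Suc t))"
     "entries (U t) = insert (g t) (entries (U (Suc t)))" if "t \<in> Cl" for t
    using h that by (auto simp: g_def simp del: set_concat)
  have eO: "entries (U (Suc t)) = insert t (entries (U t))" if t: "t \<in> Op" for t
  proof -
    obtain i where "U (Suc t) = add_cell t i (U t)" using U(2)[of t] t unfolding Q_def by blast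
    then show ?thesis using entries_add_cell(1) by simp
  qed
  have en: "U (Suc t) = U t" if "t \<notin> Cl" "t \<notin> Op" for t
    using U(2)[of t] that unfolding Q_def by blast
  have eU: "x < t" if "x \<in> entries (U t)" for x t using U(1)[of t] that unfolding P_def by blast
  have later: "entries (U (Suc t)) \<subseteq> insert t (entries (U t))" for t
  proof -
    consider "t \<in> Cl" | "t \<in> Op" | "t \<notin> Cl" "t \<notin> Op" by blast
    then show ?thesis
    proof cases
      case 1 then show ?thesis using g(3) by blast
    next
      case 2 then show ?thesis using eO by blast
    next
      case 3 then show ?thesis using en by auto
    qed
  qed
  \<comment> \<open>Position \<open>n\<close> can add no entry other than \<open>n\<close>, so a
    smaller entry that is absent stays absent.\<close>
  have gone: "x \<notin> entries (U t)" if "x \<notin> entries (U s)" "x < s" "s \<le> t" for x s t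
    using that(3)
  proof (induction rule: dec_induct)
    case base show ?case by (rule that)
  next
    case (step n)
    have "x \<noteq> n" using step(1) that(2) by simp
    then show ?case using later[of n] step(3) by blast
  qed
  have gin: "g t \<in> entries (U t)" if "t \<in> Cl" for t using g(3)[OF that] by blast
  have glt: "g t < t" if "t \<in> Cl" for t using gin[OF that] eU by blast
  have sub: "entries (U t) \<subseteq> Op" for t
  proof (induction t)
    case 0
    then show ?case using eU by blast
  next
    case (Suc t)
    show ?case
    proof (cases "t \<in> Op")
      case True then show ?thesis using eO Suc by auto
    next
      case False
      show ?thesis
      proof (cases "t \<in> Cl")
        case True then show ?thesis using g(3) Suc by blast
      next
        case F: False then show ?thesis using en[OF F False] Suc by simp
      qed
    qed
  qed
  \<comment> \<open>\<open>g s\<close> is ejected at \<open>s\<close> and never returns, whereas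
    \<open>g t\<close> is still present at \<open>t\<close>.\<close>
  have inj: "g s \<noteq> g t" if st: "s \<in> Cl" "t \<in> Cl" "s < t" for s t
  proof -
    have "g s \<notin> entries (U t)"
      using g(2)[OF st(1)] glt[OF st(1)] st(3) by (intro gone[of "g s" "Suc s" t]) auto
    then show ?thesis using gin[OF st(2)] by metis
  qed
  have Uend: "U t = []" if "N \<le> t" for t
  proof (cases "U t")
    case (Cons r T)
    then have "(0, 0) \<in> cells (U t)" using U(1)[of t] unfolding P_def by auto
    then show ?thesis using U(1)[of t] ZN[OF that] unfolding P_def by auto
  qed
  \<comment> \<open>An opener that is never ejected would persist to positions beyond
    \<open>N\<close>, where the shapes are empty.\<close>
  have surj: "x \<in> g ` Cl" if x: "x \<in> Op" for x
  proof (rule ccontr)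
    assume nx: "x \<notin> g ` Cl"
    have "x \<in> entries (U t)" if "Suc x \<le> t" for t
      using that
    proof (induction rule: dec_induct)
      case base show ?case using eO[OF x] by simp
    next
      case (step n)
      consider "n \<in> Cl" | "n \<in> Op" | "n \<notin> Cl" "n \<notin> Op" by blast
      then show ?case
      proof cases
        case 1 then show ?thesis using g(3)[OF 1] nx step(3) by blast
      next
        case 2 then show ?thesis using eO[OF 2] step(3) by blast
      next
        case 3 then show ?thesis using en[OF 3] step(3) by simp
      qed
    qed
    from this[of "max N (Suc x)"] show False using Uend[of "max N (Suc x)"] by simp
  qed
  have "inj_on g Cl" by (rule linorder_inj_onI) (use inj in auto)
  moreover have "g ` Cl = Op" using surj sub gin by blast
  ultimately have gm: "g \<in> matchings"
    using glt unfolding matchings_def bij_betw_def by (auto simp: g_def)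
  \<comment> \<open>Insertion leads from \<open>Suc t\<close> to \<open>t\<close>, so the comparison
    runs downwards from \<open>N\<close>, where both tableaux are empty. At an opener the entry
    \<open>t\<close> is cancelled from equal tableaux.\<close>
  have "tableau_at g t = U t" for t
  proof (cases "t \<le> N")
    case True
    then show ?thesis
    proof (induction rule: inc_induct)
      case base show ?case by (simp add: Uend open_word_end)
    next
      case (step t)
      consider "t \<in> Cl" | "t \<in> Op" | "t \<notin> Cl" "t \<notin> Op" by blast
      then show ?case
      proof cases
        case 1 then show ?thesis using tableau_at_closer[OF gm 1] g(1)[OF 1] step by simp
      next
        case 2
        obtain i where i: "U (Suc t) = add_cell t i (U t)" using U(2)[of t] 2 unfolding Q_def by blast
        obtain j where j: "tableau_at g (Suc t) = add_cell t j (tableau_at g t)"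
          using tableau_at_opener[OF gm 2] by blast
        have "t \<notin> entries (U t)" "t \<notin> entries (tableau_at g t)"
          using eU entries_tableau_at[OF gm] by blast+
        moreover have "is_tableau (U t)" "is_tableau (tableau_at g t)"
          using U(1) tableau_at[OF gm] unfolding P_def by blast+
        ultimately show ?thesis using add_cell_cancel[of t j "tableau_at g t" i "U t"] i j step by simp
      next
        case 3 then show ?thesis using tableau_at_other[OF gm 3] en[OF 3] step by simp
      qed
    qed
  qed (simp add: Uend open_word_end)
  then have "\<forall>t. cells (tableau_at g t) = Z t" using U(1) unfolding P_def by simp
  then show ?thesis using gm unfolding Z_def by blast
qed

section \<open>Chains of arcs in a matching\<close>

definition matching_chain :: "(nat \<Rightarrow> nat \<Rightarrow> bool) \<Rightarrow> (nat \<Rightarrow> nat) \<Rightarrow> nat \<Rightarrow> bool" where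
  "matching_chain R f k \<longleftrightarrow> (\<exists>t. has_chain R k (open_word f t))"

text \<open>The shapes of the image are the transposed shapes of the argument, and shapes determine
  a matching; this gives injectivity.\<close>

lemma matchings_transposition:
  "\<exists>\<Psi>. inj_on \<Psi> matchings \<and> \<Psi> ` matchings \<subseteq> matchings \<and>
     (\<forall>f\<in>matchings. \<forall>k. (matching_chain (<) (\<Psi> f) k \<longleftrightarrow> matching_chain (>) f k) \<and>
        (matching_chain (>) (\<Psi> f) k \<longleftrightarrow> matching_chain (<) f k))"
proof -
  obtain \<Psi> where \<Psi>: "\<And>f. f \<in> matchings \<Longrightarrow> \<Psi> f \<in> matchings"
    "\<And>f t. f \<in> matchings \<Longrightarrow> cells (tableau_at (\<Psi> f) t) = prod.swap ` cells (tableau_at f t)"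
    using transposed_matching_exists by metis
  have "inj_on \<Psi> matchings"
  proof (rule inj_onI)
    fix f g assume fg: "f \<in> matchings" "g \<in> matchings" "\<Psi> f = \<Psi> g"
    then have "prod.swap ` cells (tableau_at f t) = prod.swap ` cells (tableau_at g t)" for t
      using \<Psi>(2) by metis
    then have "cells (tableau_at f t) = cells (tableau_at g t)" for t
      by (simp add: inj_image_eq_iff)
    then show "f = g" using matching_determined_by_shapes fg by blast
  qed
  moreover have "(matching_chain (<) (\<Psi> f) k \<longleftrightarrow> matching_chain (>) f k) \<and>
        (matching_chain (>) (\<Psi> f) k \<longleftrightarrow> matching_chain (<) f k)" if f: "f \<in> matchings" for f k
  proof -
    have "(j, i) \<in> cells (tableau_at (\<Psi> f) t) \<longleftrightarrow> (i, j) \<in> cells (tableau_at f t)" for i j t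
      unfolding \<Psi>(2)[OF f] by force
    then show ?thesis
      unfolding matching_chain_def chain_insertion_tableau[OF distinct_open_word[OF f]]
        chain_insertion_tableau[OF distinct_open_word[OF \<Psi>(1)[OF f]]] by simp
  qed
  ultimately show ?thesis using \<Psi>(1) by blast
qed

text \<open>The word at \<open>t\<close> lists openers by decreasing closers, so its subsequences
  correspond to decreasing lists of closers whose arcs all straddle \<open>t\<close>.\<close>

lemma matching_chain_iff:
  "matching_chain R f k \<longleftrightarrow> (\<exists>bs. length bs = k \<and> sorted_wrt (>) bs \<and> sorted_wrt R (map f bs) \<and>
      set bs \<subseteq> Cl \<and> (\<exists>t. \<forall>b\<in>set bs. f b < t \<and> t \<le> b))"
proof
  assume "matching_chain R f k"
  then obtain t s where s: "subseq s (open_word f t)" "sorted_wrt R s" "length s = k"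
    unfolding matching_chain_def has_chain_def by blast
  define L where "L = filter (\<lambda>b. b \<in> Cl \<and> f b < t) (rev [t..<N])"
  \<comment> \<open>The index set \<open>I\<close> lifts the subsequence of openers to the list of
    their closers.\<close>
  obtain I where "s = nths (map f L) I"
    using s(1) unfolding subseq_conv_nths open_word_def L_def by blast
  then have sI: "s = map f (nths L I)" by (simp add: nths_map)
  have "sorted_wrt (>) (rev [t..<N])" by (simp add: sorted_wrt_rev)
  then have "sorted_wrt (>) L" unfolding L_def by (rule sorted_wrt_filter)
  then have "sorted_wrt (>) (nths L I)" using subseq_sorted_wrt subseq_conv_nths by metis
  moreover have "set (nths L I) \<subseteq> set L" by (rule set_nths_subset)
  then have "\<forall>b\<in>set (nths L I). b \<in> Cl \<and> f b < t \<and> t \<le> b" by (auto simp: L_def)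
  ultimately show "\<exists>bs. length bs = k \<and> sorted_wrt (>) bs \<and> sorted_wrt R (map f bs) \<and>
      set bs \<subseteq> Cl \<and> (\<exists>t. \<forall>b\<in>set bs. f b < t \<and> t \<le> b)"
    using s sI by (intro exI[of _ "nths L I"]) auto
next
  assume "\<exists>bs. length bs = k \<and> sorted_wrt (>) bs \<and> sorted_wrt R (map f bs) \<and>
      set bs \<subseteq> Cl \<and> (\<exists>t. \<forall>b\<in>set bs. f b < t \<and> t \<le> b)"
  then obtain bs t where bs: "length bs = k" "sorted_wrt (>) bs" "sorted_wrt R (map f bs)"
    "set bs \<subseteq> Cl" "\<forall>b\<in>set bs. f b < t \<and> t \<le> b" by blast
  define L where "L = filter (\<lambda>b. b \<in> Cl \<and> f b < t) (rev [t..<N])"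
  have sub: "set bs \<subseteq> set L" using bs closers by (auto simp: L_def)
  have sL: "sorted_wrt (>) (filter (\<lambda>b. b \<in> set bs) L)"
    unfolding L_def by (intro sorted_wrt_filter) (simp add: sorted_wrt_rev)
  \<comment> \<open>Strictly sorted lists with equal element sets are equal, which exhibits
    \<open>bs\<close> as a sublist of \<open>L\<close>.\<close>
  have "rev bs = rev (filter (\<lambda>b. b \<in> set bs) L)"
  proof (rule strict_sorted_equal)
    show "sorted_wrt (<) (rev (filter (\<lambda>b. b \<in> set bs) L))"
      using sL by (simp add: sorted_wrt_rev)
    show "sorted_wrt (<) (rev bs)" using bs(2) by (simp add: sorted_wrt_rev)
    show "set (rev bs) = set (rev (filter (\<lambda>b. b \<in> set bs) L))" using sub by auto
  qed
  then have "bs = filter (\<lambda>b. b \<in> set bs) L" by simp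
  then have "subseq bs L" by (metis subseq_filter_left)
  then have "subseq (map f bs) (open_word f t)" unfolding open_word_def L_def by (rule subseq_map)
  then show "matching_chain R f k"
    using bs unfolding matching_chain_def has_chain_def by (metis length_map)
qed

end

section \<open>Arc sets\<close>

definition arc_set :: "(nat \<times> nat) set \<Rightarrow> bool" where
  "arc_set F \<longleftrightarrow> finite F \<and> (\<forall>p\<in>F. fst p \<le> snd p) \<and> inj_on fst F \<and> inj_on snd F"

definition crossing_in :: "(nat \<times> nat) set \<Rightarrow> nat \<Rightarrow> bool" where
  "crossing_in F k \<longleftrightarrow> (\<exists>i j. (\<forall>t\<in>{1..k}. (i t, j t) \<in> F) \<and>
        (\<forall>s\<in>{1..k}. \<forall>t\<in>{1..k}. s < t \<longrightarrow> i s < i t \<and> j s < j t) \<and> (1 \<le> k \<longrightarrow> i k \<le> j 1))"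

definition nesting_in :: "(nat \<times> nat) set \<Rightarrow> nat \<Rightarrow> bool" where
  "nesting_in F k \<longleftrightarrow> (\<exists>i j. (\<forall>t\<in>{1..k}. (i t, j t) \<in> F) \<and>
        (\<forall>s\<in>{1..k}. \<forall>t\<in>{1..k}. s < t \<longrightarrow> i s < i t \<and> j t < j s) \<and> (1 \<le> k \<longrightarrow> i k \<le> j k))"

text \<open>Common form of crossings (\<open>R\<close> is \<open>>\<close>) and nestings
  (\<open>R\<close> is \<open><\<close>), with arcs by decreasing right ends as in
  \<open>open_word\<close>. The condition on all pairs replaces the single inequality between the
  largest left end and the smallest right end, whose indices differ in the two cases.\<close>

definition arc_chain :: "(nat \<Rightarrow> nat \<Rightarrow> bool) \<Rightarrow> (nat \<times> nat) set \<Rightarrow> nat \<Rightarrow> bool" where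
  "arc_chain R F k \<longleftrightarrow> (\<exists>ps. length ps = k \<and> set ps \<subseteq> F \<and>
     sorted_wrt (\<lambda>p q. R (fst p) (fst q) \<and> snd q < snd p) ps \<and>
     (\<forall>p\<in>set ps. \<forall>q\<in>set ps. fst p \<le> snd q))"

lemma crossing_in_iff: "crossing_in F k \<longleftrightarrow> arc_chain (>) F k"
proof
  assume "crossing_in F k"
  then obtain i j where ij: "\<And>t. t \<in> {1..k} \<Longrightarrow> (i t, j t) \<in> F"
      "\<And>s t. s \<in> {1..k} \<Longrightarrow> t \<in> {1..k} \<Longrightarrow> s < t \<Longrightarrow> i s < i t \<and> j s < j t" "1 \<le> k \<Longrightarrow> i k \<le> j 1"
    unfolding crossing_in_def by blast
  \<comment> \<open>The indices are reversed because a crossing is numbered by increasing right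
    ends; \<open>k - m\<close> runs through \<open>k\<close>, ..., \<open>1\<close>.\<close>
  define ps where "ps = map (\<lambda>m. (i (k - m), j (k - m))) [0..<k]"
  have "length ps = k" by (simp add: ps_def)
  moreover have "set ps \<subseteq> F" using ij(1) by (auto simp: ps_def)
  moreover have "sorted_wrt (\<lambda>p q. fst q < fst p \<and> snd q < snd p) ps"
    using ij(2) by (auto simp: ps_def sorted_wrt_iff_nth_less)
  moreover have "fst p \<le> snd q" if pq: "p \<in> set ps" "q \<in> set ps" for p q
  proof -
    obtain a b where ab: "a < k" "b < k" "p = (i (k - a), j (k - a))" "q = (i (k - b), j (k - b))"
      using pq by (auto simp: ps_def)
    have mono: "i s \<le> i t" "j s \<le> j t" if "s \<in> {1..k}" "t \<in> {1..k}" "s \<le> t" for s t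
      using ij(2)[of s t] that by (cases "s = t", auto)+
    have "i (k - a) \<le> i k" using ab by (intro mono) auto
    also have "i k \<le> j 1" using ij(3) ab by simp
    also have "j 1 \<le> j (k - b)" using ab by (intro mono) auto
    finally show ?thesis using ab by simp
  qed
  ultimately show "arc_chain (>) F k" unfolding arc_chain_def by blast
next
  assume "arc_chain (>) F k"
  then obtain ps where ps: "length ps = k" "set ps \<subseteq> F"
     "sorted_wrt (\<lambda>p q. fst q < fst p \<and> snd q < snd p) ps" "\<forall>p\<in>set ps. \<forall>q\<in>set ps. fst p \<le> snd q"
    unfolding arc_chain_def by blast
  have mem: "ps ! (k - t) \<in> set ps" if "t \<in> {1..k}" for t using that ps(1) by auto
  show "crossing_in F k"
    unfolding crossing_in_def
  proof (rule exI[of _ "\<lambda>t. fst (ps ! (k - t))"], rule exI[of _ "\<lambda>t. snd (ps ! (k - t))"], intro conjI ballI impI)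
    fix t assume "t \<in> {1..k}"
    then show "(fst (ps ! (k - t)), snd (ps ! (k - t))) \<in> F" using mem ps(2) by auto
  next
    fix s t assume st: "s \<in> {1..k}" "t \<in> {1..k}" "s < t"
    then show "fst (ps ! (k - s)) < fst (ps ! (k - t))" "snd (ps ! (k - s)) < snd (ps ! (k - t))"
      using sorted_wrt_nth_less[OF ps(3), of "k - t" "k - s"] ps(1) by auto
  next
    assume "1 \<le> k"
    then show "fst (ps ! (k - k)) \<le> snd (ps ! (k - 1))" using ps(4) mem[of k] mem[of 1] by simp
  qed
qed

lemma nesting_in_iff: "nesting_in F k \<longleftrightarrow> arc_chain (<) F k"
proof
  assume "nesting_in F k"
  then obtain i j where ij: "\<And>t. t \<in> {1..k} \<Longrightarrow> (i t, j t) \<in> F"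
      "\<And>s t. s \<in> {1..k} \<Longrightarrow> t \<in> {1..k} \<Longrightarrow> s < t \<Longrightarrow> i s < i t \<and> j t < j s" "1 \<le> k \<Longrightarrow> i k \<le> j k"
    unfolding nesting_in_def by blast
  define ps where "ps = map (\<lambda>m. (i (Suc m), j (Suc m))) [0..<k]"
  have "length ps = k" by (simp add: ps_def)
  moreover have "set ps \<subseteq> F" using ij(1) by (auto simp: ps_def)
  moreover have "sorted_wrt (\<lambda>p q. fst p < fst q \<and> snd q < snd p) ps"
    using ij(2) by (auto simp: ps_def sorted_wrt_iff_nth_less)
  moreover have "fst p \<le> snd q" if pq: "p \<in> set ps" "q \<in> set ps" for p q
  proof -
    obtain a b where ab: "a < k" "b < k" "p = (i (Suc a), j (Suc a))" "q = (i (Suc b), j (Suc b))"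
      using pq by (auto simp: ps_def)
    have mono: "i s \<le> i t" "j t \<le> j s" if "s \<in> {1..k}" "t \<in> {1..k}" "s \<le> t" for s t
      using ij(2)[of s t] that by (cases "s = t", auto)+
    have "i (Suc a) \<le> i k" using ab by (intro mono) auto
    also have "i k \<le> j k" using ij(3) ab by simp
    also have "j k \<le> j (Suc b)" using ab by (intro mono) auto
    finally show ?thesis using ab by simp
  qed
  ultimately show "arc_chain (<) F k" unfolding arc_chain_def by blast
next
  assume "arc_chain (<) F k"
  then obtain ps where ps: "length ps = k" "set ps \<subseteq> F"
     "sorted_wrt (\<lambda>p q. fst p < fst q \<and> snd q < snd p) ps" "\<forall>p\<in>set ps. \<forall>q\<in>set ps. fst p \<le> snd q"
    unfolding arc_chain_def by blast
  have mem: "ps ! (t - 1) \<in> set ps" if "t \<in> {1..k}" for t using that ps(1) by auto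
  show "nesting_in F k"
    unfolding nesting_in_def
  proof (rule exI[of _ "\<lambda>t. fst (ps ! (t - 1))"], rule exI[of _ "\<lambda>t. snd (ps ! (t - 1))"], intro conjI ballI impI)
    fix t assume "t \<in> {1..k}"
    then show "(fst (ps ! (t - 1)), snd (ps ! (t - 1))) \<in> F" using mem ps(2) by auto
  next
    fix s t assume st: "s \<in> {1..k}" "t \<in> {1..k}" "s < t"
    then show "fst (ps ! (s - 1)) < fst (ps ! (t - 1))" "snd (ps ! (t - 1)) < snd (ps ! (s - 1))"
      using sorted_wrt_nth_less[OF ps(3), of "s - 1" "t - 1"] ps(1) by auto
  next
    assume "1 \<le> k"
    then show "fst (ps ! (k - 1)) \<le> snd (ps ! (k - 1))" using ps(4) mem[of k] by simp
  qed
qed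

text \<open>Doubling the positions separates the two roles of a point, the opener coming first; this turns
  the weak inequality \<open>i \<le> j\<close> of enhanced crossings and nestings into a strict one.\<close>

definition doubled_openers :: "(nat \<times> nat) set \<Rightarrow> nat set" where
  "doubled_openers F = (\<lambda>i. 2 * i) ` fst ` F"

definition doubled_closers :: "(nat \<times> nat) set \<Rightarrow> nat set" where
  "doubled_closers F = (\<lambda>j. Suc (2 * j)) ` snd ` F"

text \<open>The inserted \<open>0\<close> keeps \<open>Max\<close> meaningful for the empty arc
  set.\<close>

definition doubled_bound :: "(nat \<times> nat) set \<Rightarrow> nat" where
  "doubled_bound F = Suc (Max (insert 0 (doubled_closers F)))"

text \<open>For \<open>b\<close> = 2 j + 1 the number \<open>b div 2\<close> is j, and the inverse
  of \<open>snd\<close> on \<open>F\<close> finds the unique arc ending there.\<close>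

definition opener_map :: "(nat \<times> nat) set \<Rightarrow> nat \<Rightarrow> nat" where
  "opener_map F = restrict (\<lambda>b. 2 * fst (the_inv_into F snd (b div 2))) (doubled_closers F)"

definition arcs_of :: "nat set \<Rightarrow> (nat \<Rightarrow> nat) \<Rightarrow> (nat \<times> nat) set" where
  "arcs_of Cl f = (\<lambda>b. (f b div 2, b div 2)) ` Cl"

lemma endpoints_doubled:
  assumes "arc_set F"
  shows "endpoints (doubled_bound F) (doubled_openers F) (doubled_closers F)"
proof
  show "doubled_openers F \<inter> doubled_closers F = {}"
    unfolding doubled_openers_def doubled_closers_def by (auto, presburger)
  have "finite (doubled_closers F)" using assms by (simp add: arc_set_def doubled_closers_def)
  then show "doubled_closers F \<subseteq> {..<doubled_bound F}"
    unfolding doubled_bound_def by (auto simp: less_Suc_eq_le)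
qed

lemma opener_map_arc:
  assumes "arc_set F" "(i, j) \<in> F"
  shows "opener_map F (Suc (2 * j)) = 2 * i"
proof -
  have "the_inv_into F snd j = (i, j)"
    using assms the_inv_into_f_f[of snd F "(i, j)"] by (auto simp: arc_set_def)
  moreover have "Suc (2 * j) \<in> doubled_closers F" using assms(2) by (force simp: doubled_closers_def)
  ultimately show ?thesis by (simp add: opener_map_def)
qed

lemma arcs_of_opener_map:
  assumes "arc_set F"
  shows "arcs_of (doubled_closers F) (opener_map F) = F"
proof -
  have "arcs_of (doubled_closers F) (opener_map F) =
      (\<lambda>p. (opener_map F (Suc (2 * snd p)) div 2, snd p)) ` F"
    by (simp add: arcs_of_def doubled_closers_def image_image)
  also have "\<dots> = (\<lambda>p. p) ` F"
    using opener_map_arc[OF assms] by (intro image_cong) auto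
  finally show ?thesis by simp
qed

lemma opener_map_matching:
  assumes "arc_set F"
  shows "opener_map F \<in> endpoints.matchings (doubled_openers F) (doubled_closers F)"
proof -
  interpret endpoints "doubled_bound F" "doubled_openers F" "doubled_closers F"
    using endpoints_doubled[OF assms] .
  have 1: "opener_map F ` doubled_closers F = doubled_openers F"
  proof -
    have "opener_map F ` doubled_closers F = (\<lambda>p. opener_map F (Suc (2 * snd p))) ` F"
      by (simp add: doubled_closers_def image_image)
    also have "\<dots> = (\<lambda>p. 2 * fst p) ` F" using opener_map_arc[OF assms] by (intro image_cong) auto
    finally show ?thesis by (simp add: doubled_openers_def image_image)
  qed
  have 2: "inj_on (opener_map F) (doubled_closers F)"
  proof (rule inj_onI)
    fix b c assume bc: "b \<in> doubled_closers F" "c \<in> doubled_closers F" "opener_map F b = opener_map F c"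
    obtain i j i' j' where "(i, j) \<in> F" "b = Suc (2 * j)" "(i', j') \<in> F" "c = Suc (2 * j')"
      using bc by (force simp: doubled_closers_def)
    moreover have "i = i'" using calculation bc(3) opener_map_arc[OF assms] by simp
    moreover have "inj_on fst F" using assms by (simp add: arc_set_def)
    ultimately show "b = c" using inj_onD[of fst F "(i, j)" "(i', j')"] by simp
  qed
  have 3: "opener_map F b < b" if b: "b \<in> doubled_closers F" for b
  proof -
    obtain i j where "(i, j) \<in> F" "b = Suc (2 * j)" using b by (force simp: doubled_closers_def)
    then show ?thesis using opener_map_arc[OF assms] assms by (force simp: arc_set_def)
  qed
  show ?thesis using 1 2 3 by (auto simp: matchings_def bij_betw_def opener_map_def)
qed

text \<open>Openers are even and closers odd, so halving loses no information. Any matching of the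
  same doubled endpoints thus gives an arc set with the same endpoints as \<open>F\<close>; the
  strict 2 i < 2 j + 1 becomes i \<le> j again.\<close>

lemma arcs_of_matching:
  assumes F: "arc_set F" and f: "f \<in> endpoints.matchings (doubled_openers F) (doubled_closers F)"
  shows "b \<in> doubled_closers F \<Longrightarrow> f b = 2 * (f b div 2) \<and> b = Suc (2 * (b div 2))"
    and "arc_set (arcs_of (doubled_closers F) f)"
    and "fst ` arcs_of (doubled_closers F) f = fst ` F"
    and "snd ` arcs_of (doubled_closers F) f = snd ` F"
proof -
  interpret endpoints "doubled_bound F" "doubled_openers F" "doubled_closers F"
    using endpoints_doubled[OF F] .
  have f': "inj_on f (doubled_closers F)" "f ` doubled_closers F = doubled_openers F"
    "\<And>b. b \<in> doubled_closers F \<Longrightarrow> f b < b"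
    using f by (auto simp: matchings_def bij_betw_def)
  show ev: "f b = 2 * (f b div 2) \<and> b = Suc (2 * (b div 2))" if b: "b \<in> doubled_closers F" for b
  proof -
    have "f b \<in> doubled_openers F" using b f'(2) by blast
    then show ?thesis using b by (auto simp: doubled_openers_def doubled_closers_def)
  qed
  have fst: "fst ` arcs_of (doubled_closers F) f = (\<lambda>a. a div 2) ` doubled_openers F"
    unfolding f'(2)[symmetric] by (simp add: arcs_of_def image_image)
  then show "fst ` arcs_of (doubled_closers F) f = fst ` F"
    by (simp add: doubled_openers_def image_image)
  show "snd ` arcs_of (doubled_closers F) f = snd ` F"
    by (simp add: doubled_closers_def arcs_of_def image_image)
  have fin: "finite (doubled_closers F)" using F by (simp add: arc_set_def doubled_closers_def)
  have i1: "b = c" if "b \<in> doubled_closers F" "c \<in> doubled_closers F" "f b div 2 = f c div 2" for b c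
    using ev[OF that(1)] ev[OF that(2)] that f'(1) by (metis inj_onD)
  have i2: "b = c" if "b \<in> doubled_closers F" "c \<in> doubled_closers F" "b div 2 = c div 2" for b c
    using ev[OF that(1)] ev[OF that(2)] that by metis
  have le: "f b div 2 \<le> b div 2" if "b \<in> doubled_closers F" for b
    using f'(3)[OF that] by (simp add: div_le_mono)
  let ?C = "doubled_closers F"
  show "arc_set (arcs_of (doubled_closers F) f)"
    unfolding arc_set_def arcs_of_def
  proof (intro conjI inj_onI)
    fix p q assume pq: "p \<in> (\<lambda>b. (f b div 2, b div 2)) ` ?C" "q \<in> (\<lambda>b. (f b div 2, b div 2)) ` ?C"
    then obtain b c where bc: "b \<in> ?C" "c \<in> ?C" "p = (f b div 2, b div 2)" "q = (f c div 2, c div 2)"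
      by blast
    show "fst p = fst q \<Longrightarrow> p = q" using bc i1[OF bc(1,2)] by simp
    show "snd p = snd q \<Longrightarrow> p = q" using bc i2[OF bc(1,2)] by simp
  qed (use fin le in auto)
qed

lemma matching_chain_arc_chain:
  assumes F: "arc_set F" and f: "f \<in> endpoints.matchings (doubled_openers F) (doubled_closers F)"
    and R: "R = (<) \<or> R = (>)"
  shows "endpoints.matching_chain (doubled_bound F) (doubled_closers F) R f k \<longleftrightarrow>
     arc_chain R (arcs_of (doubled_closers F) f) k"
proof -
  interpret endpoints "doubled_bound F" "doubled_openers F" "doubled_closers F"
    using endpoints_doubled[OF F] .
  let ?C = "doubled_closers F"
  note ev = arcs_of_matching(1)[OF F f]
  have R2: "R (2 * x) (2 * y) \<longleftrightarrow> R x y" for x y using R by auto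
  show ?thesis
  proof
    assume "matching_chain R f k"
    then obtain bs t where bs: "length bs = k" "sorted_wrt (>) bs" "sorted_wrt R (map f bs)"
      "set bs \<subseteq> ?C" and t: "\<And>b. b \<in> set bs \<Longrightarrow> f b < t \<and> t \<le> b"
      unfolding matching_chain_iff by blast
    define ps where "ps = map (\<lambda>b. (f b div 2, b div 2)) bs"
    have "set ps \<subseteq> arcs_of ?C f" using bs(4) by (auto simp: ps_def arcs_of_def)
    moreover have "sorted_wrt (\<lambda>p q. R (fst p) (fst q) \<and> snd q < snd p) ps"
    proof -
      have "sorted_wrt (\<lambda>b c. R (f b) (f c) \<and> c < b) bs"
        using bs(2,3) by (auto simp: sorted_wrt_iff_nth_less)
      then show ?thesis unfolding ps_def sorted_wrt_map
      proof (rule sorted_wrt_mono_rel[rotated])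
        fix b c assume "b \<in> set bs" "c \<in> set bs" and h: "R (f b) (f c) \<and> c < b"
        then have e: "f b = 2 * (f b div 2)" "b = Suc (2 * (b div 2))"
          "f c = 2 * (f c div 2)" "c = Suc (2 * (c div 2))" using ev bs(4) by blast+
        have "R (f b div 2) (f c div 2)" using h R2 e(1,3) by metis
        moreover have "c div 2 < b div 2" using h e(2,4) by linarith
        ultimately show "R (fst (f b div 2, b div 2)) (fst (f c div 2, c div 2)) \<and>
           snd (f c div 2, c div 2) < snd (f b div 2, b div 2)" by simp
      qed
    qed
    moreover have "fst p \<le> snd q" if pq: "p \<in> set ps" "q \<in> set ps" for p q
    proof -
      obtain b c where bc: "b \<in> set bs" "c \<in> set bs" "p = (f b div 2, b div 2)" "q = (f c div 2, c div 2)"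
        using pq by (auto simp: ps_def)
      have "f b \<le> c" using t[OF bc(1)] t[OF bc(2)] by simp
      then show ?thesis using bc by (simp add: div_le_mono)
    qed
    ultimately show "arc_chain R (arcs_of ?C f) k"
      using bs(1) unfolding arc_chain_def by (intro exI[of _ ps]) (auto simp: ps_def)
  next
    assume "arc_chain R (arcs_of ?C f) k"
    then obtain ps where ps: "length ps = k" "set ps \<subseteq> arcs_of ?C f"
     "sorted_wrt (\<lambda>p q. R (fst p) (fst q) \<and> snd q < snd p) ps"
     "\<And>p q. p \<in> set ps \<Longrightarrow> q \<in> set ps \<Longrightarrow> fst p \<le> snd q"
      unfolding arc_chain_def by blast
    define bs where "bs = map (\<lambda>p. Suc (2 * snd p)) ps"
    have fb: "Suc (2 * snd p) \<in> ?C \<and> f (Suc (2 * snd p)) = 2 * fst p" if p: "p \<in> set ps" for p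
    proof -
      obtain b where b: "b \<in> ?C" "p = (f b div 2, b div 2)" using p ps(2) by (auto simp: arcs_of_def)
      have "Suc (2 * snd p) = b" using ev[OF b(1)] b(2) by (metis snd_conv)
      then show ?thesis using ev[OF b(1)] b by (metis fst_conv)
    qed
    have "sorted_wrt (>) bs" unfolding bs_def sorted_wrt_map
      by (rule sorted_wrt_mono_rel[OF _ ps(3)]) auto
    moreover have "sorted_wrt R (map f bs)"
      unfolding bs_def map_map sorted_wrt_map
      by (rule sorted_wrt_mono_rel[OF _ ps(3)]) (auto simp: fb R2)
    moreover have "set bs \<subseteq> ?C" using fb by (auto simp: bs_def)
    moreover have "\<exists>t. \<forall>b\<in>set bs. f b < t \<and> t \<le> b"
    proof (cases "ps = []")
      case False
      \<comment> \<open>The common position is the odd number just after the doubled largest opener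
        \<open>m\<close>; it is no larger than any closer 2 j + 1 because \<open>m\<close> \<le> j
        for all arcs of the chain.\<close>
      define m where "m = Max (fst ` set ps)"
      have "m \<in> fst ` set ps" unfolding m_def using False by (intro Max_in) auto
      then obtain p where "p \<in> set ps" "m = fst p" by blast
      then have "m \<le> snd q" if "q \<in> set ps" for q using ps(4) that by blast
      moreover have "fst p \<le> m" if "p \<in> set ps" for p unfolding m_def using that by simp
      ultimately have "2 * fst p < Suc (2 * m) \<and> Suc (2 * m) \<le> Suc (2 * snd p)" if "p \<in> set ps" for p
        using that by (simp add: less_Suc_eq_le)
      then show ?thesis using fb by (intro exI[of _ "Suc (2 * m)"]) (auto simp: bs_def)
    qed (simp add: bs_def)
    ultimately show "matching_chain R f k"
      unfolding matching_chain_iff using ps(1) by (intro exI[of _ bs]) (auto simp: bs_def)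
  qed
qed

lemma arc_set_transposition:
  "\<exists>\<Psi>. inj_on \<Psi> {F. arc_set F} \<and> (\<forall>F. arc_set F \<longrightarrow>
     arc_set (\<Psi> F) \<and> fst ` \<Psi> F = fst ` F \<and> snd ` \<Psi> F = snd ` F \<and>
     (\<forall>k. (crossing_in (\<Psi> F) k \<longleftrightarrow> nesting_in F k) \<and> (nesting_in (\<Psi> F) k \<longleftrightarrow> crossing_in F k)))"
proof -
  let ?M = "\<lambda>A C. endpoints.matchings A C"
  define good where "good N A C \<psi> \<longleftrightarrow> inj_on \<psi> (?M A C) \<and> \<psi> ` (?M A C) \<subseteq> ?M A C \<and>
     (\<forall>f\<in>?M A C. \<forall>k. (endpoints.matching_chain N C (<) (\<psi> f) k \<longleftrightarrow> endpoints.matching_chain N C (>) f k) \<and>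
        (endpoints.matching_chain N C (>) (\<psi> f) k \<longleftrightarrow> endpoints.matching_chain N C (<) f k))" for N A C \<psi>
  \<comment> \<open>One map is chosen for each triple of endpoint data rather than for each arc set.
    Arc sets with the same endpoints are therefore treated by the same injection, and the image
    reveals the endpoints; the injectivity of \<open>\<Psi>\<close> rests on this.\<close>
  define \<psi> where "\<psi> N A C = (SOME \<psi>. good N A C \<psi>)" for N A C
  have good: "good N A C (\<psi> N A C)" if "endpoints N A C" for N A C
  proof -
    have "\<exists>\<psi>. good N A C \<psi>"
      unfolding good_def by (rule endpoints.matchings_transposition[OF that])
    then show ?thesis unfolding \<psi>_def by (rule someI_ex)
  qed
  define \<Phi> where "\<Phi> F = \<psi> (doubled_bound F) (doubled_openers F) (doubled_closers F) (opener_map F)" for F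
  define \<Psi> where "\<Psi> F = arcs_of (doubled_closers F) (\<Phi> F)" for F
  have \<Phi>: "\<Phi> F \<in> ?M (doubled_openers F) (doubled_closers F)" if F: "arc_set F" for F
  proof -
    let ?\<psi> = "\<psi> (doubled_bound F) (doubled_openers F) (doubled_closers F)"
    have "?\<psi> ` ?M (doubled_openers F) (doubled_closers F) \<subseteq> ?M (doubled_openers F) (doubled_closers F)"
      using good[OF endpoints_doubled[OF F]] unfolding good_def by (elim conjE)
    from subsetD[OF this imageI[OF opener_map_matching[OF F]]] show ?thesis
      unfolding \<Phi>_def .
  qed
  have A: "b \<in> doubled_closers F \<Longrightarrow> \<Phi> F b = 2 * (\<Phi> F b div 2) \<and> b = Suc (2 * (b div 2))"
    "arc_set (\<Psi> F)" "fst ` \<Psi> F = fst ` F" "snd ` \<Psi> F = snd ` F" if F: "arc_set F" for F b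
    unfolding \<Psi>_def using arcs_of_matching[OF F \<Phi>[OF F]] by blast+
  have chains: "(crossing_in (\<Psi> F) k \<longleftrightarrow> nesting_in F k) \<and> (nesting_in (\<Psi> F) k \<longleftrightarrow> crossing_in F k)"
    if F: "arc_set F" for F k
  proof -
    let ?mc = "endpoints.matching_chain (doubled_bound F) (doubled_closers F)"
    have "?mc (<) (\<Phi> F) k \<longleftrightarrow> ?mc (>) (opener_map F) k" "?mc (>) (\<Phi> F) k \<longleftrightarrow> ?mc (<) (opener_map F) k"
      using good[OF endpoints_doubled[OF F]] opener_map_matching[OF F] unfolding good_def \<Phi>_def by simp_all
    moreover have "?mc R (\<Phi> F) k \<longleftrightarrow> arc_chain R (\<Psi> F) k" if "R = (<) \<or> R = (>)" for R
      unfolding \<Psi>_def by (rule matching_chain_arc_chain[OF F \<Phi>[OF F] that])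
    moreover have "?mc R (opener_map F) k \<longleftrightarrow> arc_chain R F k" if "R = (<) \<or> R = (>)" for R
      using matching_chain_arc_chain[OF F opener_map_matching[OF F] that] arcs_of_opener_map[OF F] by simp
    ultimately show ?thesis unfolding crossing_in_iff nesting_in_iff by simp
  qed
  have "inj_on \<Psi> {F. arc_set F}"
  proof (rule inj_onI, simp only: mem_Collect_eq)
    fix F G assume F: "arc_set F" and G: "arc_set G" and e: "\<Psi> F = \<Psi> G"
    have "fst ` F = fst ` G" "snd ` F = snd ` G" using A(3)[OF F] A(3)[OF G] A(4)[OF F] A(4)[OF G] e by auto
    then have o: "doubled_openers F = doubled_openers G" and c: "doubled_closers F = doubled_closers G"
      by (simp_all add: doubled_openers_def doubled_closers_def)
    then have n: "doubled_bound F = doubled_bound G" by (simp add: doubled_bound_def)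
    have pt: "\<Phi> F b = \<Phi> G b" if b: "b \<in> doubled_closers F" for b
    proof -
      have "(\<Phi> F b div 2, b div 2) \<in> \<Psi> G" using b e unfolding \<Psi>_def arcs_of_def by blast
      then obtain b' where b': "b' \<in> doubled_closers G" "\<Phi> F b div 2 = \<Phi> G b' div 2" "b div 2 = b' div 2"
        unfolding \<Psi>_def arcs_of_def by auto
      have "b = b'" using A(1)[OF F b] A(1)[OF G b'(1)] b'(3) by metis
      then show ?thesis using A(1)[OF F b] A(1)[OF G b'(1)] b'(2) by metis
    qed
    \<comment> \<open>The arcs of the image fix the function on the closers only; extensionality
      makes the functions equal.\<close>
    have ext: "\<Phi> H \<in> extensional (doubled_closers H)" if H: "arc_set H" for H
      using \<Phi>[OF H] by (simp add: endpoints.matchings_def[OF endpoints_doubled[OF H]])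
    have "\<Phi> F \<in> extensional (doubled_closers F)" "\<Phi> G \<in> extensional (doubled_closers F)"
      using ext[OF F] ext[OF G] c by simp_all
    then have eq: "\<Phi> F = \<Phi> G" using pt by (rule extensionalityI)
    have inj: "inj_on (\<psi> (doubled_bound G) (doubled_openers G) (doubled_closers G))
        (?M (doubled_openers G) (doubled_closers G))"
      using good[OF endpoints_doubled[OF G]] unfolding good_def by (elim conjE)
    have mF: "opener_map F \<in> ?M (doubled_openers G) (doubled_closers G)"
      using opener_map_matching[OF F] o c by simp
    have "opener_map F = opener_map G"
      by (rule inj_onD[OF inj eq[unfolded \<Phi>_def o c n] mF opener_map_matching[OF G]])
    then show "F = G" using arcs_of_opener_map[OF F] arcs_of_opener_map[OF G] c by metis
  qed
  then show ?thesis using A(2-4) chains by (intro exI[of _ \<Psi>]) simp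
qed

section \<open>Partitions and their enhanced arcs\<close>

text \<open>These turn out to be exactly the enhanced arc sets of partitions of [n]. Every point is
  covered since a singleton block carries a loop.\<close>

definition spanning_arcs :: "nat \<Rightarrow> (nat \<times> nat) set \<Rightarrow> bool" where
  "spanning_arcs n E \<longleftrightarrow> arc_set E \<and> fst ` E \<union> snd ` E = {1..n}"

lemma partition_block_eq:
  assumes "partition_on A P" "B \<in> P" "B' \<in> P" "x \<in> B" "x \<in> B'"
  shows "B = B'"
  using assms unfolding partition_on_def disjoint_def by blast

lemma Arc_endpoints:
  assumes P: "partition_on {1..n} P"
  shows "fst ` Arc P = {1..n} - max_set P" "snd ` Arc P = {1..n} - min_set P"
    "min_set P \<subseteq> {1..n}" "max_set P \<subseteq> {1..n}"
proof -
  note B = partition_on_finite_block[OF P]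
  have U: "\<Union> P = {1..n}" using P by (simp add: partition_on_def)
  show "min_set P \<subseteq> {1..n}" "max_set P \<subseteq> {1..n}"
    using B Min_in Max_in unfolding min_set_def max_set_def by blast+
  show "fst ` Arc P = {1..n} - max_set P"
  proof (intro equalityI subsetI)
    fix i assume "i \<in> fst ` Arc P"
    then obtain j C where C: "C \<in> P" "i \<in> C" "j \<in> C" "i < j" by (auto simp: Arc_def)
    have "i \<noteq> Max D" if D: "D \<in> P" for D
    proof
      assume e: "i = Max D"
      then have "i \<in> D" using B[OF D] Max_in by blast
      then have "D = C" using partition_block_eq[OF P D C(1)] C by blast
      then show False using e C B[OF D] by (metis Max_ge leD)
    qed
    then show "i \<in> {1..n} - max_set P" using C U by (auto simp: max_set_def)
  next
    fix i assume i: "i \<in> {1..n} - max_set P"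
    then obtain C where C: "C \<in> P" "i \<in> C" using U by blast
    have fin: "finite {k \<in> C. i < k}" using B[OF C(1)] by simp
    have "Max C \<noteq> i" using i C by (auto simp: max_set_def)
    moreover have "i \<le> Max C" "Max C \<in> C" using B[OF C(1)] C by auto
    ultimately have ne: "{k \<in> C. i < k} \<noteq> {}" by (metis (mono_tags, lifting) empty_iff le_neq_implies_less mem_Collect_eq)
    then have "Min {k \<in> C. i < k} \<in> {k \<in> C. i < k}" using fin Min_in by blast
    moreover have "\<forall>k\<in>C. i < k \<longrightarrow> Min {k \<in> C. i < k} \<le> k" using fin by auto
    ultimately have "(i, Min {k \<in> C. i < k}) \<in> Arc P" using C unfolding Arc_def by blast
    then show "i \<in> fst ` Arc P" by force
  qed
  show "snd ` Arc P = {1..n} - min_set P"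
  proof (intro equalityI subsetI)
    fix j assume "j \<in> snd ` Arc P"
    then obtain i C where C: "C \<in> P" "i \<in> C" "j \<in> C" "i < j" by (auto simp: Arc_def)
    have "j \<noteq> Min D" if D: "D \<in> P" for D
    proof
      assume e: "j = Min D"
      then have "j \<in> D" using B[OF D] Min_in by blast
      then have "D = C" using partition_block_eq[OF P D C(1)] C by blast
      then show False using e C B[OF D] by (metis Min_le leD)
    qed
    then show "j \<in> {1..n} - min_set P" using C U by (auto simp: min_set_def)
  next
    fix j assume j: "j \<in> {1..n} - min_set P"
    then obtain C where C: "C \<in> P" "j \<in> C" using U by blast
    let ?K = "{k \<in> C. k < j}"
    have fin: "finite ?K" using B[OF C(1)] by simp
    have "Min C \<noteq> j" using j C by (auto simp: min_set_def)
    moreover have "Min C \<le> j" "Min C \<in> C" using B[OF C(1)] C by auto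
    ultimately have ne: "?K \<noteq> {}" by (metis (mono_tags, lifting) empty_iff le_neq_implies_less mem_Collect_eq)
    then have M: "Max ?K \<in> ?K" using fin Max_in by blast
    moreover have "\<forall>k\<in>C. Max ?K < k \<longrightarrow> j \<le> k"
    proof (intro ballI impI)
      fix k assume "k \<in> C" "Max ?K < k"
      then show "j \<le> k" using Max_ge[OF fin, of k] by (metis (mono_tags, lifting) leD mem_Collect_eq not_le)
    qed
    ultimately have "(Max ?K, j) \<in> Arc P" using C unfolding Arc_def by blast
    then show "j \<in> snd ` Arc P" by force
  qed
qed

lemma Arc_less: "(i, j) \<in> Arc P \<Longrightarrow> i < j"
  by (auto simp: Arc_def)

lemma Arc_unique:
  assumes P: "partition_on {1..n} P"
  shows "(i, j) \<in> Arc P \<Longrightarrow> (i, j') \<in> Arc P \<Longrightarrow> j = j'"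
    and "(i, j) \<in> Arc P \<Longrightarrow> (i', j) \<in> Arc P \<Longrightarrow> i = i'"
proof -
  show "j = j'" if a: "(i, j) \<in> Arc P" "(i, j') \<in> Arc P"
  proof -
    obtain C where C: "C \<in> P" "i \<in> C" "j \<in> C" "i < j" "\<forall>k\<in>C. i < k \<longrightarrow> j \<le> k"
      using a(1) by (auto simp: Arc_def)
    obtain D where D: "D \<in> P" "i \<in> D" "j' \<in> D" "i < j'" "\<forall>k\<in>D. i < k \<longrightarrow> j' \<le> k"
      using a(2) by (auto simp: Arc_def)
    have "C = D" using partition_block_eq[OF P C(1) D(1)] C D by blast
    then show ?thesis using C D by (meson antisym)
  qed
  show "i = i'" if a: "(i, j) \<in> Arc P" "(i', j) \<in> Arc P"
  proof -
    obtain C where C: "C \<in> P" "i \<in> C" "j \<in> C" "i < j" "\<forall>k\<in>C. i < k \<longrightarrow> j \<le> k"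
      using a(1) by (auto simp: Arc_def)
    obtain D where D: "D \<in> P" "i' \<in> D" "j \<in> D" "i' < j" "\<forall>k\<in>D. i' < k \<longrightarrow> j \<le> k"
      using a(2) by (auto simp: Arc_def)
    have "C = D" using partition_block_eq[OF P C(1) D(1)] C D by blast
    then show ?thesis using C D by (meson leD linorder_neqE_nat)
  qed
qed

text \<open>Ordinary arcs start at the non-maximal and end at the non-minimal points; the loops put
  back the points that are both minimal and maximal. Hence min - max and max - min are the
  complements of the closers and of the openers.\<close>

lemma enhanced_Arc_endpoints:
  assumes P: "partition_on {1..n} P"
  shows "fst ` enhanced_Arc P = {1..n} - (max_set P - min_set P)"
    "snd ` enhanced_Arc P = {1..n} - (min_set P - max_set P)"
    "spanning_arcs n (enhanced_Arc P)"
proof -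
  note E = Arc_endpoints[OF P]
  let ?L = "{(i, i) | i. i \<in> min_set P \<inter> max_set P}"
  have L: "fst ` ?L = min_set P \<inter> max_set P" "snd ` ?L = min_set P \<inter> max_set P" by force+
  show 1: "fst ` enhanced_Arc P = {1..n} - (max_set P - min_set P)"
    unfolding enhanced_Arc_def image_Un E L using E(3,4) by blast
  show 2: "snd ` enhanced_Arc P = {1..n} - (min_set P - max_set P)"
    unfolding enhanced_Arc_def image_Un E L using E(3,4) by blast
  have c: "fst ` enhanced_Arc P \<union> snd ` enhanced_Arc P = {1..n}" unfolding 1 2 by blast
  have fin: "finite (enhanced_Arc P)"
    using enhanced_Arc_subset[OF P] by (rule finite_subset) simp
  have le: "\<forall>p\<in>enhanced_Arc P. fst p \<le> snd p"
    using Arc_less by (fastforce simp: enhanced_Arc_def)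
  have nf: "i \<notin> max_set P" "j \<notin> min_set P" if "(i, j) \<in> Arc P" for i j
  proof -
    have "i \<in> fst ` Arc P" "j \<in> snd ` Arc P" using that by force+
    then show "i \<notin> max_set P" "j \<notin> min_set P" unfolding E by blast+
  qed
  have "inj_on fst (enhanced_Arc P)"
  proof (rule inj_onI)
    fix p q assume "p \<in> enhanced_Arc P" "q \<in> enhanced_Arc P" "fst p = fst q"
    then show "p = q" unfolding enhanced_Arc_def
      using Arc_unique(1)[OF P] nf(1) by (cases p; cases q) auto
  qed
  moreover have "inj_on snd (enhanced_Arc P)"
  proof (rule inj_onI)
    fix p q assume "p \<in> enhanced_Arc P" "q \<in> enhanced_Arc P" "snd p = snd q"
    then show "p = q" unfolding enhanced_Arc_def
      using Arc_unique(2)[OF P] nf(2) by (cases p; cases q) auto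
  qed
  ultimately show "spanning_arcs n (enhanced_Arc P)"
    using fin le c by (simp add: spanning_arcs_def arc_set_def)
qed

section \<open>Blocks as the components of the arc graph\<close>

lemma block_Arc_path:
  assumes P: "partition_on {1..n} P" and B: "B \<in> P"
  shows "x \<in> B \<Longrightarrow> y \<in> B \<Longrightarrow> x \<le> y \<Longrightarrow> (x, y) \<in> (Arc P)\<^sup>*"
proof (induction "y - x" arbitrary: x rule: less_induct)
  case less
  show ?case
  proof (cases "x = y")
    case False
    then have xy: "x < y" using less by simp
    let ?K = "{k \<in> B. x < k}"
    have fin: "finite ?K" using partition_on_finite_block(1)[OF P B] by simp
    have y: "y \<in> ?K" using xy less by simp
    then have M: "Min ?K \<in> ?K" using fin Min_in by blast
    have My: "Min ?K \<le> y" using fin y by (rule Min_le)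
    have "\<forall>k\<in>B. x < k \<longrightarrow> Min ?K \<le> k" using fin by auto
    then have a: "(x, Min ?K) \<in> Arc P" using M less B unfolding Arc_def by blast
    have "(Min ?K, y) \<in> (Arc P)\<^sup>*" using M My xy less by (intro less.hyps) auto
    then show ?thesis using a by (rule converse_rtrancl_into_rtrancl[rotated])
  qed simp
qed

lemma Arc_path_block:
  assumes P: "partition_on {1..n} P" and B: "B \<in> P" and "(x, y) \<in> (Arc P)\<^sup>*"
  shows "x \<in> B \<longleftrightarrow> y \<in> B"
  using assms(3)
proof (induction rule: rtrancl_induct)
  case (step y z)
  obtain C where "C \<in> P" "y \<in> C" "z \<in> C" using step(2) by (auto simp: Arc_def)
  then have "y \<in> B \<longleftrightarrow> z \<in> B" using partition_block_eq[OF P B] by blast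
  then show ?case using step by simp
qed simp

text \<open>Two points share a block exactly when an arc path leads from the smaller to the larger
  one, so the arcs alone determine the blocks.\<close>

lemma partition_eq_of_Arc:
  assumes P: "partition_on {1..n} P" and Q: "partition_on {1..n} Q" and e: "Arc P = Arc Q"
  shows "P = Q"
proof -
  have "P \<subseteq> Q" if P: "partition_on {1..n} P" and Q: "partition_on {1..n} Q" and e: "Arc P = Arc Q" for P Q
  proof
    fix B assume B: "B \<in> P"
    then obtain x where x: "x \<in> B" using partition_on_finite_block[OF P] by blast
    then have "x \<in> {1..n}" using partition_on_finite_block(3)[OF P B] by blast
    then have "x \<in> \<Union> Q" using Q by (simp add: partition_on_def)
    then obtain C where C: "C \<in> Q" "x \<in> C" by blast
    have "y \<in> B \<longleftrightarrow> y \<in> C" for y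
    proof
      assume y: "y \<in> B"
      then have "(x, y) \<in> (Arc P)\<^sup>* \<or> (y, x) \<in> (Arc P)\<^sup>*" using block_Arc_path[OF P B] x by (meson linear)
      then show "y \<in> C" using Arc_path_block[OF Q C(1)] C(2) e by metis
    next
      assume y: "y \<in> C"
      then have "(x, y) \<in> (Arc Q)\<^sup>* \<or> (y, x) \<in> (Arc Q)\<^sup>*" using block_Arc_path[OF Q C(1)] C(2) by (meson linear)
      then show "y \<in> B" using Arc_path_block[OF P B] x e by metis
    qed
    then have "B = C" by blast
    then show "B \<in> Q" using C by simp
  qed
  from this[OF P Q e] this[OF Q P e[symmetric]] show ?thesis by blast
qed

lemma Arc_eq_off_diagonal: "Arc P = enhanced_Arc P - Id"
  using Arc_less by (fastforce simp: enhanced_Arc_def)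

text \<open>By the two single-valuedness conditions the graph is a disjoint union of increasing
  paths, and these are taken as blocks.\<close>

lemma partition_of_Arc_exists:
  fixes A :: "(nat \<times> nat) set"
  assumes sub: "A \<subseteq> {1..n} \<times> {1..n}" and less: "\<And>i j. (i, j) \<in> A \<Longrightarrow> i < j"
    and sv: "single_valued A" "single_valued (A\<inverse>)"
  shows "\<exists>P. partition_on {1..n} P \<and> Arc P = A"
proof -
  define R where "R = {(x, y). x \<in> {1..n} \<and> y \<in> {1..n} \<and> ((x, y) \<in> A\<^sup>* \<or> (y, x) \<in> A\<^sup>*)}"
  \<comment> \<open>Arcs neither branch nor merge, so two paths leaving, or two paths entering, the
    same point are comparable; transitivity of \<open>R\<close> reduces to this.\<close>
  have fwd: "(y, z) \<in> A\<^sup>* \<or> (z, y) \<in> A\<^sup>*" if "(x, y) \<in> A\<^sup>*" "(x, z) \<in> A\<^sup>*" for x y z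
    using single_valued_confluent[OF sv(1)] that by blast
  have bwd: "(y, z) \<in> A\<^sup>* \<or> (z, y) \<in> A\<^sup>*" if "(y, x) \<in> A\<^sup>*" "(z, x) \<in> A\<^sup>*" for x y z
  proof -
    have "(x, y) \<in> (A\<inverse>)\<^sup>*" "(x, z) \<in> (A\<inverse>)\<^sup>*" using that by (auto simp: rtrancl_converse)
    then have "(y, z) \<in> (A\<inverse>)\<^sup>* \<or> (z, y) \<in> (A\<inverse>)\<^sup>*" using single_valued_confluent[OF sv(2)] by blast
    then show ?thesis by (auto simp: rtrancl_converse)
  qed
  have eqv: "equiv {1..n} R"
  proof (rule equivI)
    show "R \<subseteq> {1..n} \<times> {1..n}" by (auto simp: R_def)
    show "refl_on {1..n} R" by (auto simp: refl_on_def R_def)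
    show "sym R" by (auto simp: sym_def R_def)
    show "trans R"
    proof (rule transI)
      fix x y z assume xy: "(x, y) \<in> R" and yz: "(y, z) \<in> R"
      have "(x, z) \<in> A\<^sup>* \<or> (z, x) \<in> A\<^sup>*"
        using xy yz fwd[of y x z] bwd[of x y z] rtrancl_trans[of x y A z] rtrancl_trans[of z y A x]
        unfolding R_def by blast
      then show "(x, z) \<in> R" using xy yz by (auto simp: R_def)
    qed
  qed
  have le: "x \<le> y" if "(x, y) \<in> A\<^sup>*" for x y
    using that by (induction rule: rtrancl_induct) (auto dest: less)
  have first: "\<exists>j. (x, j) \<in> A \<and> (j, y) \<in> A\<^sup>*" if "(x, y) \<in> R" "x < y" for x y
  proof -
    have "(x, y) \<in> A\<^sup>*" using that le[of y x] by (auto simp: R_def)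
    then show ?thesis using that(2) by (auto elim: converse_rtranclE)
  qed
  let ?P = "{1..n} // R"
  \<comment> \<open>Only one class contains \<open>x\<close>, so a condition \<open>S\<close> on an
    unspecified block can be read as one on the class of \<open>x\<close>.\<close>
  have blk: "(\<exists>B\<in>?P. x \<in> B \<and> y \<in> B \<and> S B) \<longleftrightarrow> (x, y) \<in> R \<and> S (R `` {x})" for x y S
  proof
    assume "\<exists>B\<in>?P. x \<in> B \<and> y \<in> B \<and> S B"
    then obtain B where B: "B \<in> ?P" "x \<in> B" "y \<in> B" "S B" by blast
    have "(x, y) \<in> R" using quotient_eq_iff[OF eqv B(1) B(1) B(2,3)] by simp
    moreover have "B = R `` {x}"
    proof -
      obtain z where z: "B = R `` {z}" using B(1) by (auto simp: quotient_def)
      then have "(z, x) \<in> R" using B(2) by blast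
      then show ?thesis using z equiv_class_eq[OF eqv] by blast
    qed
    ultimately show "(x, y) \<in> R \<and> S (R `` {x})" using B(4) by simp
  next
    assume a: "(x, y) \<in> R \<and> S (R `` {x})"
    then have "x \<in> {1..n}" "x \<in> R `` {x}" by (auto simp: R_def)
    then show "\<exists>B\<in>?P. x \<in> B \<and> y \<in> B \<and> S B" using a by (intro bexI[of _ "R `` {x}"]) (auto intro: quotientI)
  qed
  have Arc: "(i, j) \<in> Arc ?P \<longleftrightarrow> (i, j) \<in> R \<and> i < j \<and> (\<forall>k\<in>R `` {i}. i < k \<longrightarrow> j \<le> k)" for i j
    using blk[of i j "\<lambda>B. i < j \<and> (\<forall>k\<in>B. i < k \<longrightarrow> j \<le> k)"] by (simp add: Arc_def)
  have "Arc ?P = A"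
  proof (rule set_eqI, clarify)
    fix i j
    show "(i, j) \<in> Arc ?P \<longleftrightarrow> (i, j) \<in> A"
    proof
      assume "(i, j) \<in> Arc ?P"
      then have a: "(i, j) \<in> R" "i < j" "\<forall>k\<in>R `` {i}. i < k \<longrightarrow> j \<le> k" using Arc by blast+
      obtain j' where j': "(i, j') \<in> A" "(j', j) \<in> A\<^sup>*" using first[OF a(1,2)] by blast
      have "(i, j') \<in> R" using j'(1) sub by (auto simp: R_def)
      then have "j \<le> j'" using a(3) less[OF j'(1)] by blast
      then have "j = j'" using le[OF j'(2)] by simp
      then show "(i, j) \<in> A" using j' by simp
    next
      assume a: "(i, j) \<in> A"
      have R: "(i, j) \<in> R" using a sub by (auto simp: R_def)
      have "j \<le> k" if k: "(i, k) \<in> R" "i < k" for k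
      proof -
        obtain j' where j': "(i, j') \<in> A" "(j', k) \<in> A\<^sup>*" using first[OF k] by blast
        have "j' = j" using sv(1) a j'(1) by (auto simp: single_valued_def)
        then show ?thesis using le[OF j'(2)] by simp
      qed
      then show "(i, j) \<in> Arc ?P" using Arc R less[OF a] by blast
    qed
  qed
  moreover have "partition_on {1..n} ?P" using eqv by (rule partition_on_quotient)
  ultimately show ?thesis by blast
qed

text \<open>The arcs off the diagonal define the partition. Its singleton blocks are the points on
  no such arc; they carry loops because \<open>E\<close> covers [n], and injectivity of both
  projections keeps loops off all other points.\<close>

lemma partition_of_spanning_arcs:
  assumes E: "spanning_arcs n E"
  shows "\<exists>P. partition_on {1..n} P \<and> enhanced_Arc P = E"
proof -
  have E': "\<And>i j. (i, j) \<in> E \<Longrightarrow> i \<le> j" "inj_on fst E" "inj_on snd E" "fst ` E \<union> snd ` E = {1..n}"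
    using E by (auto simp: spanning_arcs_def arc_set_def)
  have f: "j = j'" if "(i, j) \<in> E" "(i, j') \<in> E" for i j j' using inj_onD[OF E'(2) _ that] by simp
  have s: "i = i'" if "(i, j) \<in> E" "(i', j) \<in> E" for i i' j using inj_onD[OF E'(3) _ that] by simp
  have mem: "i \<in> {1..n}" "j \<in> {1..n}" if "(i, j) \<in> E" for i j
    using that E'(4) by (metis UnCI fst_conv image_eqI snd_conv)+
  let ?A = "E - Id"
  have "\<exists>P. partition_on {1..n} P \<and> Arc P = ?A"
  proof (rule partition_of_Arc_exists)
    show "?A \<subseteq> {1..n} \<times> {1..n}" using mem by (auto simp del: atLeastAtMost_iff)
    show "i < j" if "(i, j) \<in> ?A" for i j using that E'(1)[of i j] by auto
    show "single_valued ?A" using f by (auto simp: single_valued_def)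
    show "single_valued (?A\<inverse>)" using s by (auto simp: single_valued_def)
  qed
  then obtain P where P: "partition_on {1..n} P" "Arc P = ?A" by blast
  note ends = Arc_endpoints[OF P(1)]
  have iso: "i \<in> min_set P \<inter> max_set P \<longleftrightarrow> i \<in> {1..n} \<and> i \<notin> fst ` ?A \<and> i \<notin> snd ` ?A" for i
    using ends unfolding P(2) by blast
  have "(i, i) \<in> E \<longleftrightarrow> i \<in> {1..n} \<and> i \<notin> fst ` ?A \<and> i \<notin> snd ` ?A" for i
  proof
    assume a: "(i, i) \<in> E"
    then show "i \<in> {1..n} \<and> i \<notin> fst ` ?A \<and> i \<notin> snd ` ?A" using mem[OF a] f[OF a] s[OF a] by force
  next
    assume a: "i \<in> {1..n} \<and> i \<notin> fst ` ?A \<and> i \<notin> snd ` ?A"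
    then have "i \<in> fst ` E \<union> snd ` E" using E'(4) by blast
    then show "(i, i) \<in> E" using a by force
  qed
  then have "enhanced_Arc P = E" unfolding enhanced_Arc_def P(2) using iso by auto
  then show ?thesis using P by blast
qed

section \<open>Colour classes\<close>

definition color_class :: "colored_partition \<Rightarrow> nat \<Rightarrow> (nat \<times> nat) set" where
  "color_class \<Lambda> c = {e \<in> enhanced_Arc (fst \<Lambda>). snd \<Lambda> e = c}"

lemma has_crossing_iff: "has_crossing \<Lambda> k \<longleftrightarrow> (\<exists>c. crossing_in (color_class \<Lambda> c) k)"
  unfolding has_crossing_def crossing_in_def monochromatic_arcs_def color_class_def mem_Collect_eq
  by blast

lemma has_nesting_iff: "has_nesting \<Lambda> k \<longleftrightarrow> (\<exists>c. nesting_in (color_class \<Lambda> c) k)"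
  unfolding has_nesting_def nesting_in_def monochromatic_arcs_def color_class_def mem_Collect_eq
  by blast

lemma arc_set_subset: "arc_set E \<Longrightarrow> F \<subseteq> E \<Longrightarrow> arc_set F"
  unfolding arc_set_def by (meson finite_subset inj_on_subset subsetD)

lemma colored_enhanced_partitions_color_class:
  assumes "\<Lambda> \<in> colored_enhanced_partitions n r"
  shows "arc_set (color_class \<Lambda> c)" "c \<notin> {1..r} \<Longrightarrow> color_class \<Lambda> c = {}"
    "enhanced_Arc (fst \<Lambda>) = (\<Union>c. color_class \<Lambda> c)"
proof -
  have P: "partition_on {1..n} (fst \<Lambda>)" and \<phi>: "snd \<Lambda> \<in> enhanced_Arc (fst \<Lambda>) \<rightarrow>\<^sub>E {1..r}"
    using assms by (auto simp: colored_enhanced_partitions_def)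
  have "arc_set (enhanced_Arc (fst \<Lambda>))"
    using enhanced_Arc_endpoints(3)[OF P] by (simp add: spanning_arcs_def)
  then show "arc_set (color_class \<Lambda> c)"
    by (rule arc_set_subset) (auto simp: color_class_def)
  show "color_class \<Lambda> c = {}" if "c \<notin> {1..r}"
    using \<phi> that by (auto simp: color_class_def dest: PiE_mem simp del: atLeastAtMost_iff)
  show "enhanced_Arc (fst \<Lambda>) = (\<Union>c. color_class \<Lambda> c)" by (auto simp: color_class_def)
qed

text \<open>The union of the classes is the enhanced arc set, whose off-diagonal part determines the
  partition; the extensional colouring is then fixed by its values on the arcs.\<close>

lemma colored_partition_eqI:
  assumes \<Lambda>: "\<Lambda> \<in> colored_enhanced_partitions n r" and M: "M \<in> colored_enhanced_partitions n r"
    and eq: "\<And>c. color_class \<Lambda> c = color_class M c"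
  shows "\<Lambda> = M"
proof -
  have P: "partition_on {1..n} (fst \<Lambda>)" "partition_on {1..n} (fst M)"
    and \<phi>: "snd \<Lambda> \<in> enhanced_Arc (fst \<Lambda>) \<rightarrow>\<^sub>E {1..r}" "snd M \<in> enhanced_Arc (fst M) \<rightarrow>\<^sub>E {1..r}"
    using \<Lambda> M by (auto simp: colored_enhanced_partitions_def)
  have E: "enhanced_Arc (fst \<Lambda>) = enhanced_Arc (fst M)"
    using colored_enhanced_partitions_color_class(3)[OF \<Lambda>] colored_enhanced_partitions_color_class(3)[OF M] eq
    by simp
  then have "fst \<Lambda> = fst M" using partition_eq_of_Arc[OF P] Arc_eq_off_diagonal by metis
  moreover have "snd \<Lambda> = snd M"
  proof (rule PiE_ext[OF \<phi>(1)])
    show "snd M \<in> enhanced_Arc (fst \<Lambda>) \<rightarrow>\<^sub>E {1..r}" using \<phi>(2) E by simp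
    fix e assume "e \<in> enhanced_Arc (fst \<Lambda>)"
    then have "e \<in> color_class \<Lambda> (snd \<Lambda> e)" by (simp add: color_class_def)
    then have "e \<in> color_class M (snd \<Lambda> e)" by (simp only: eq)
    then show "snd \<Lambda> e = snd M e" by (simp add: color_class_def)
  qed
  ultimately show ?thesis by (rule prod_eqI)
qed

text \<open>\<open>\<Psi>\<close> acts on each class separately. The opener sets of different
  classes are disjoint and preserved, and likewise the closer sets, so the new classes are disjoint
  and their union is again a spanning arc set.\<close>

lemma recolored_partition_exists:
  assumes \<Lambda>: "\<Lambda> \<in> colored_enhanced_partitions n r"
    and \<Psi>: "\<And>F. arc_set F \<Longrightarrow> arc_set (\<Psi> F) \<and> fst ` \<Psi> F = fst ` F \<and> snd ` \<Psi> F = snd ` F"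
  shows "\<exists>M\<in>colored_enhanced_partitions n r. (\<forall>c. color_class M c = \<Psi> (color_class \<Lambda> c)) \<and>
     mins M - maxs M = mins \<Lambda> - maxs \<Lambda> \<and> maxs M - mins M = maxs \<Lambda> - mins \<Lambda>"
proof -
  let ?F = "color_class \<Lambda>"
  let ?E = "enhanced_Arc (fst \<Lambda>)"
  note C = colored_enhanced_partitions_color_class[OF \<Lambda>]
  have P: "partition_on {1..n} (fst \<Lambda>)" using \<Lambda> by (auto simp: colored_enhanced_partitions_def)
  have E: "arc_set ?E" "fst ` ?E \<union> snd ` ?E = {1..n}"
    using enhanced_Arc_endpoints(3)[OF P] by (simp_all add: spanning_arcs_def)
  define E' where "E' = (\<Union>c. \<Psi> (?F c))"
  have G: "arc_set (\<Psi> (?F c))" "fst ` \<Psi> (?F c) = fst ` ?F c" "snd ` \<Psi> (?F c) = snd ` ?F c" for c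
    using \<Psi>[OF C(1)] by blast+
  have fst': "fst ` E' = fst ` ?E" and snd': "snd ` E' = snd ` ?E"
    unfolding E'_def C(3) image_UN G by simp_all
  \<comment> \<open>An opener already determines the colour of its arc in \<open>\<Lambda>\<close>,
    and each new class has the openers of the old one.\<close>
  have col_fst: "c = d" if pq: "p \<in> \<Psi> (?F c)" "q \<in> \<Psi> (?F d)" "fst p = fst q" for p q c d
  proof -
    have "fst p \<in> fst ` ?F c" "fst p \<in> fst ` ?F d"
      using imageI[OF pq(1), of fst] imageI[OF pq(2), of fst] pq(3) by (simp_all only: G(2))
    then obtain p' q' where "p' \<in> ?F c" "q' \<in> ?F d" "fst p' = fst q'" by auto
    then have "p' \<in> ?E" "q' \<in> ?E" "fst p' = fst q'" "snd \<Lambda> p' = c" "snd \<Lambda> q' = d"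
      by (simp_all add: color_class_def)
    moreover have "inj_on fst ?E" using E(1) by (simp add: arc_set_def)
    ultimately show ?thesis using inj_onD[of fst ?E p' q'] by metis
  qed
  have col_snd: "c = d" if pq: "p \<in> \<Psi> (?F c)" "q \<in> \<Psi> (?F d)" "snd p = snd q" for p q c d
  proof -
    have "snd p \<in> snd ` ?F c" "snd p \<in> snd ` ?F d"
      using imageI[OF pq(1), of snd] imageI[OF pq(2), of snd] pq(3) by (simp_all only: G(3))
    then obtain p' q' where "p' \<in> ?F c" "q' \<in> ?F d" "snd p' = snd q'" by auto
    then have "p' \<in> ?E" "q' \<in> ?E" "snd p' = snd q'" "snd \<Lambda> p' = c" "snd \<Lambda> q' = d"
      by (simp_all add: color_class_def)
    moreover have "inj_on snd ?E" using E(1) by (simp add: arc_set_def)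
    ultimately show ?thesis using inj_onD[of snd ?E p' q'] by metis
  qed
  have out: "\<Psi> (?F c) = {}" if "c \<notin> {1..r}" for c
    using G(2)[of c] C(2)[OF that] by simp
  have "finite E'"
  proof -
    have "E' = (\<Union>c\<in>{1..r}. \<Psi> (?F c))" unfolding E'_def using out by blast
    then show ?thesis using G(1) by (simp add: arc_set_def)
  qed
  moreover have "\<forall>p\<in>E'. fst p \<le> snd p" using G(1) unfolding E'_def arc_set_def by blast
  moreover have "inj_on fst E'"
  proof (rule inj_onI)
    fix p q assume pq: "p \<in> E'" "q \<in> E'" "fst p = fst q"
    then obtain c d where cd: "p \<in> \<Psi> (?F c)" "q \<in> \<Psi> (?F d)" unfolding E'_def by blast
    then have "c = d" using col_fst pq(3) by blast
    moreover have "inj_on fst (\<Psi> (?F c))" using G(1)[of c] by (simp add: arc_set_def)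
    ultimately show "p = q" using cd pq(3) by (metis inj_onD)
  qed
  moreover have "inj_on snd E'"
  proof (rule inj_onI)
    fix p q assume pq: "p \<in> E'" "q \<in> E'" "snd p = snd q"
    then obtain c d where cd: "p \<in> \<Psi> (?F c)" "q \<in> \<Psi> (?F d)" unfolding E'_def by blast
    then have "c = d" using col_snd pq(3) by blast
    moreover have "inj_on snd (\<Psi> (?F c))" using G(1)[of c] by (simp add: arc_set_def)
    ultimately show "p = q" using cd pq(3) by (metis inj_onD)
  qed
  ultimately have "spanning_arcs n E'"
    using fst' snd' E(2) by (simp add: spanning_arcs_def arc_set_def)
  then obtain Q where Q: "partition_on {1..n} Q" "enhanced_Arc Q = E'"
    using partition_of_spanning_arcs by blast
  have "\<forall>e\<in>E'. \<exists>c. e \<in> \<Psi> (?F c)" by (auto simp: E'_def)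
  then obtain col where col: "\<And>e. e \<in> E' \<Longrightarrow> e \<in> \<Psi> (?F (col e))" by metis
  define M where "M = (Q, restrict col E')"
  have "col e \<in> {1..r}" if "e \<in> E'" for e using col[OF that] out by blast
  then have MX: "M \<in> colored_enhanced_partitions n r"
    using Q by (auto simp: M_def colored_enhanced_partitions_def simp del: atLeastAtMost_iff)
  have "color_class M c = \<Psi> (?F c)" for c
  proof (intro equalityI subsetI)
    fix e assume "e \<in> color_class M c"
    then have "e \<in> E'" "col e = c" using Q by (auto simp: color_class_def M_def)
    then show "e \<in> \<Psi> (?F c)" using col by blast
  next
    fix e assume e: "e \<in> \<Psi> (?F c)"
    then have "e \<in> E'" by (auto simp: E'_def)
    moreover have "col e = c" using col_fst[OF col[OF \<open>e \<in> E'\<close>] e] by simp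
    ultimately show "e \<in> color_class M c" using Q by (simp add: color_class_def M_def)
  qed
  moreover have "mins M - maxs M = mins \<Lambda> - maxs \<Lambda>" "maxs M - mins M = maxs \<Lambda> - mins \<Lambda>"
  proof -
    \<comment> \<open>Both differences depend only on the endpoint sets of the enhanced arcs, which
      are the same for \<open>\<Lambda>\<close> and \<open>M\<close>.\<close>
    have d: "min_set R - max_set R = {1..n} - snd ` enhanced_Arc R"
      "max_set R - min_set R = {1..n} - fst ` enhanced_Arc R" if R: "partition_on {1..n} R" for R
      unfolding enhanced_Arc_endpoints[OF R] using Arc_endpoints(3,4)[OF R] by blast+
    show "mins M - maxs M = mins \<Lambda> - maxs \<Lambda>" "maxs M - mins M = maxs \<Lambda> - mins \<Lambda>"
      unfolding mins_def maxs_def M_def fst_conv d[OF P] d[OF Q(1)] Q(2) fst' snd' by (rule refl)+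
  qed
  ultimately show ?thesis using MX by blast
qed

lemma crossing_nesting_injection:
  "\<exists>\<Theta>. inj_on \<Theta> (colored_enhanced_partitions n r) \<and>
     (\<forall>\<Lambda>\<in>colored_enhanced_partitions n r. \<Theta> \<Lambda> \<in> colored_enhanced_partitions n r \<and>
        mins (\<Theta> \<Lambda>) - maxs (\<Theta> \<Lambda>) = mins \<Lambda> - maxs \<Lambda> \<and> maxs (\<Theta> \<Lambda>) - mins (\<Theta> \<Lambda>) = maxs \<Lambda> - mins \<Lambda> \<and>
        cr (\<Theta> \<Lambda>) = ne \<Lambda> \<and> ne (\<Theta> \<Lambda>) = cr \<Lambda>)"
proof -
  let ?X = "colored_enhanced_partitions n r"
  obtain \<Psi> where inj: "inj_on \<Psi> {F. arc_set F}"
    and \<Psi>: "\<And>F. arc_set F \<Longrightarrow> arc_set (\<Psi> F) \<and> fst ` \<Psi> F = fst ` F \<and> snd ` \<Psi> F = snd ` F"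
    and chains: "\<And>F k. arc_set F \<Longrightarrow>
       (crossing_in (\<Psi> F) k \<longleftrightarrow> nesting_in F k) \<and> (nesting_in (\<Psi> F) k \<longleftrightarrow> crossing_in F k)"
  proof -
    obtain \<Psi> where "inj_on \<Psi> {F. arc_set F}" "\<And>F. arc_set F \<Longrightarrow>
       arc_set (\<Psi> F) \<and> fst ` \<Psi> F = fst ` F \<and> snd ` \<Psi> F = snd ` F \<and>
       (\<forall>k. (crossing_in (\<Psi> F) k \<longleftrightarrow> nesting_in F k) \<and> (nesting_in (\<Psi> F) k \<longleftrightarrow> crossing_in F k))"
      using arc_set_transposition by (elim exE conjE) simp
    then show ?thesis by (intro that[of \<Psi>]) simp_all
  qed
  have "\<forall>\<Lambda>\<in>?X. \<exists>M. M \<in> ?X \<and> (\<forall>c. color_class M c = \<Psi> (color_class \<Lambda> c)) \<and>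
     mins M - maxs M = mins \<Lambda> - maxs \<Lambda> \<and> maxs M - mins M = maxs \<Lambda> - mins \<Lambda>"
    by (intro ballI recolored_partition_exists[OF _ \<Psi>, unfolded Bex_def])
  from bchoice[OF this] obtain \<Theta> where \<Theta>: "\<forall>\<Lambda>\<in>?X. \<Theta> \<Lambda> \<in> ?X \<and> (\<forall>c. color_class (\<Theta> \<Lambda>) c = \<Psi> (color_class \<Lambda> c)) \<and>
     mins (\<Theta> \<Lambda>) - maxs (\<Theta> \<Lambda>) = mins \<Lambda> - maxs \<Lambda> \<and> maxs (\<Theta> \<Lambda>) - mins (\<Theta> \<Lambda>) = maxs \<Lambda> - mins \<Lambda>"
    by (elim exE)
  have "inj_on \<Theta> ?X"
  proof (rule inj_onI)
    fix \<Lambda> M assume LM: "\<Lambda> \<in> ?X" "M \<in> ?X" "\<Theta> \<Lambda> = \<Theta> M"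
    have "color_class \<Lambda> c = color_class M c" for c
    proof (rule inj_onD[OF inj])
      show "\<Psi> (color_class \<Lambda> c) = \<Psi> (color_class M c)" using \<Theta> LM by (metis (no_types, lifting))
      show "color_class \<Lambda> c \<in> {F. arc_set F}" "color_class M c \<in> {F. arc_set F}"
        using colored_enhanced_partitions_color_class(1) LM by blast+
    qed
    then show "\<Lambda> = M" using colored_partition_eqI LM by blast
  qed
  moreover have "cr (\<Theta> \<Lambda>) = ne \<Lambda> \<and> ne (\<Theta> \<Lambda>) = cr \<Lambda>" if \<Lambda>: "\<Lambda> \<in> ?X" for \<Lambda>
  proof -
    have cc: "color_class (\<Theta> \<Lambda>) c = \<Psi> (color_class \<Lambda> c)" for c using \<Theta> \<Lambda> by blast
    note ch = chains[OF colored_enhanced_partitions_color_class(1)[OF \<Lambda>]]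
    have "has_crossing (\<Theta> \<Lambda>) k \<longleftrightarrow> has_nesting \<Lambda> k" "has_nesting (\<Theta> \<Lambda>) k \<longleftrightarrow> has_crossing \<Lambda> k" for k
      unfolding has_crossing_iff has_nesting_iff cc using ch by blast+
    then have "has_crossing (\<Theta> \<Lambda>) = has_nesting \<Lambda>" "has_nesting (\<Theta> \<Lambda>) = has_crossing \<Lambda>"
      by (simp_all add: fun_eq_iff)
    then show ?thesis unfolding cr_def ne_def by simp
  qed
  ultimately show ?thesis using \<Theta> by blast
qed

text \<open>Stated as an inequality for arbitrary \<open>a\<close> and \<open>b\<close>; the
  instance with the two interchanged supplies the reverse one.\<close>

lemma card_crossing_nesting_le:
  "card {\<Lambda> \<in> colored_enhanced_partitions n r.
      mins \<Lambda> - maxs \<Lambda> = S \<and> maxs \<Lambda> - mins \<Lambda> = T \<and> cr \<Lambda> = a \<and> ne \<Lambda> = b}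
   \<le> card {\<Lambda> \<in> colored_enhanced_partitions n r.
      mins \<Lambda> - maxs \<Lambda> = S \<and> maxs \<Lambda> - mins \<Lambda> = T \<and> cr \<Lambda> = b \<and> ne \<Lambda> = a}"
proof -
  obtain \<Theta> where inj: "inj_on \<Theta> (colored_enhanced_partitions n r)"
    and \<Theta>: "\<forall>\<Lambda>\<in>colored_enhanced_partitions n r. \<Theta> \<Lambda> \<in> colored_enhanced_partitions n r \<and>
        mins (\<Theta> \<Lambda>) - maxs (\<Theta> \<Lambda>) = mins \<Lambda> - maxs \<Lambda> \<and> maxs (\<Theta> \<Lambda>) - mins (\<Theta> \<Lambda>) = maxs \<Lambda> - mins \<Lambda> \<and>
        cr (\<Theta> \<Lambda>) = ne \<Lambda> \<and> ne (\<Theta> \<Lambda>) = cr \<Lambda>"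
    using crossing_nesting_injection by blast
  let ?X = "\<lambda>a b. {\<Lambda> \<in> colored_enhanced_partitions n r.
      mins \<Lambda> - maxs \<Lambda> = S \<and> maxs \<Lambda> - mins \<Lambda> = T \<and> cr \<Lambda> = a \<and> ne \<Lambda> = b}"
  show ?thesis
  proof (rule card_inj_on_le[of \<Theta>])
    show "inj_on \<Theta> (?X a b)" using inj by (rule inj_on_subset) blast
    show "\<Theta> ` ?X a b \<subseteq> ?X b a"
    proof (rule image_subsetI)
      fix \<Lambda> assume "\<Lambda> \<in> ?X a b"
      then show "\<Theta> \<Lambda> \<in> ?X b a" using bspec[OF \<Theta>, of \<Lambda>] by simp
    qed
    show "finite (?X b a)" using finite_colored_enhanced_partitions by simp
  qed
qed

theorem theorem5p7:
  fixes n r :: nat and S T :: "nat set"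
  assumes "n > 0" and "r > 0" and "S \<subseteq> {1..n}" and "T \<subseteq> {1..n}"
  shows "\<forall>a b. card {\<Lambda> \<in> colored_enhanced_partitions n r.
                  mins \<Lambda> - maxs \<Lambda> = S \<and> maxs \<Lambda> - mins \<Lambda> = T \<and> cr \<Lambda> = a \<and> ne \<Lambda> = b}
             = card {\<Lambda> \<in> colored_enhanced_partitions n r.
                  mins \<Lambda> - maxs \<Lambda> = S \<and> maxs \<Lambda> - mins \<Lambda> = T \<and> cr \<Lambda> = b \<and> ne \<Lambda> = a}"
  by (intro allI antisym card_crossing_nesting_le)

end
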